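(* Let $P\subset \mathbb{R}^{n}$ be an $n$-dimensional parallelotope endowed with a reversible continuous Finsler metric $\Phi$. Let $(F_i,G_i)$, $1\leq i\leq n$, denote its pairs of opposite faces and let $d_{i} := d_{\Phi}(F_{i},G_{i})$. Then, for any ($n$-dimensional) Finsler volume $v$, $$v(P,\Phi) \geq v\left(\prod_{i=1}^{n}[0,d_{i}],\ \|\cdot\|_{\infty}\right).$$
   Context: A continuous Finsler metric on a manifold $M$ (possibly with boundary and corners, such as a parallelotope, for which $TP=P\times\mathbb{R}^n$) is a continuous function $\Phi:TM\to[0,+\infty)$ whose restriction to every tangent space is an asymmetric norm (positive definite, positively homogeneous, subadditive). It is reversible if $\Phi(-u)=\Phi(u)$ for every tangent vector $u$. The length of a piecewise-$\mathcal{C}^1$ curve $\gamma:[0,1]\to M$ is $\mathrm{length}_\Phi(\gamma)=\int_0^1\Phi(\gamma'(t))\,dt$, and $d_\Phi(x,y)$ is the infimum of $\mathrm{length}_\Phi(\gamma)$ over piecewise-$\mathcal{C}^1$ curves in $M$ from $x$ to $y$. For subsets $A,B\subset M$, $d_\Phi(A,B)=\inf_{x\in A,\,y\in B}d_\Phi(x,y)$. An $n$-dimensional Finsler volume $v$ assigns to every $n$-dimensional manifold $(M,\Phi)$ with a reversible continuous Finsler metric a Borel measure on $M$, written $v(A,\Phi)$ for Borel $A\subset M$, compatible with restriction to subdomains, and such that: (i) it is the Riemannian volume when $\Phi$ comes from a Riemannian metric; (ii) it is monotonous: for every short map $f:(M,\Phi)\to(N,\Psi)$ (i.e. $d_\Psi(f(x),f(y))\le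 d_\Phi(x,y)$ for all $x,y\in M$) between $n$-dimensional Finsler manifolds, $v(f(M),\Psi)\leq v(M,\Phi)$. In particular isometric manifolds have equal volume. Here $\|\cdot\|_\infty$ denotes the constant Finsler metric on $\mathbb{R}^n$ given by the sup norm, and $v(\prod[0,d_i],\|\cdot\|_\infty)$ is the measure of the box for this metric. *)

theory Defs
  imports "HOL-Analysis.Analysis"
begin

section \<open>Smooth maps on subsets of Euclidean space\<close>

fun C_k_on :: "nat \<Rightarrow> 'a::real_normed_vector set \<Rightarrow> ('a \<Rightarrow> 'b::real_normed_vector) \<Rightarrow> bool" where
  "C_k_on 0 W f \<longleftrightarrow> continuous_on W f"
| "C_k_on (Suc k) W f \<longleftrightarrow> (\<forall>x\<in>W. f differentiable (at x)) \<and>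
     (\<forall>h. C_k_on k W (\<lambda>x. frechet_derivative f (at x) h))"

text \<open>
  On an arbitrary set \<open>S\<close> smoothness means, as usual for manifolds with corners, that \<open>f\<close>
  extends locally around every point of \<open>S\<close> to a \<open>C\<^sup>\<infinity>\<close> map on an open set.
\<close>
definition smooth_on :: "'a::real_normed_vector set \<Rightarrow> ('a \<Rightarrow> 'b::real_normed_vector) \<Rightarrow> bool" where
  "smooth_on S f \<longleftrightarrow> (\<forall>x\<in>S. \<exists>W g. open W \<and> x \<in> W \<and> (\<forall>k. C_k_on k W g) \<and> (\<forall>y\<in>S \<inter> W. g y = f y))"

section \<open>Manifolds with boundary and corners\<close>

text \<open>
  The dimension of a manifold is \<open>CARD('n)\<close>. A chart is a pair of its domain and its coordinate
  map; the values of the coordinate map outside the domain are irrelevant.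
\<close>
type_synonym ('p, 'n) chart = "'p set \<times> ('p \<Rightarrow> real ^ 'n)"

record ('p, 'n::finite) manifold =
  mtop :: "'p topology"
  atlas :: "('p, 'n) chart set"

definition chart_inv :: "('p, 'n::finite) chart \<Rightarrow> real ^ 'n \<Rightarrow> 'p" where
  "chart_inv c = inv_into (fst c) (snd c)"

text \<open>
  The local models of a manifold with corners, \<open>k\<close> half lines times \<open>\<real>\<^sup>n\<^sup>-\<^sup>k\<close> for
  \<open>k = card I\<close>; interior points have charts with \<open>I = {}\<close>.
\<close>
definition sector :: "'n set \<Rightarrow> (real ^ 'n::finite) set" where
  "sector I = {x. \<forall>i\<in>I. 0 \<le> x $ i}"

definition smooth_manifold :: "('p, 'n::finite) manifold \<Rightarrow> bool" where
  "smooth_manifold M \<longleftrightarrow>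
     Hausdorff_space (mtop M) \<and> second_countable (mtop M) \<and>
     (\<Union>c\<in>atlas M. fst c) = topspace (mtop M) \<and>
     (\<forall>c\<in>atlas M. openin (mtop M) (fst c) \<and>
        homeomorphic_map (subtopology (mtop M) (fst c)) (top_of_set (snd c ` fst c)) (snd c) \<and>
        (\<exists>I. openin (top_of_set (sector I)) (snd c ` fst c))) \<and>
     (\<forall>c\<in>atlas M. \<forall>d\<in>atlas M. smooth_on (snd c ` (fst c \<inter> fst d)) (snd d \<circ> chart_inv c))"

text \<open>
  The standard structure of a subset of \<open>\<real>\<^sup>n\<close>, given by all charts that are diffeomorphisms. It is
  a manifold for the sets considered below, \<open>\<real>\<^sup>n\<close> itself and parallelotopes.
\<close>
definition standard_manifold :: "(real ^ 'n::finite) set \<Rightarrow> (real ^ 'n, 'n) manifold" where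
  "standard_manifold S = \<lparr> mtop = top_of_set S,
     atlas = {c. openin (top_of_set S) (fst c) \<and> inj_on (snd c) (fst c) \<and>
                 (\<exists>I. openin (top_of_set (sector I)) (snd c ` fst c)) \<and>
                 smooth_on (fst c) (snd c) \<and> smooth_on (snd c ` fst c) (chart_inv c)} \<rparr>"

section \<open>Tangent vectors\<close>

definition charts_at :: "('p, 'n::finite) manifold \<Rightarrow> 'p \<Rightarrow> ('p, 'n) chart set" where
  "charts_at M p = {c \<in> atlas M. p \<in> fst c}"

text \<open>
  A tangent vector at \<open>p\<close> is the family of its coordinate vectors in all charts at \<open>p\<close>, related by
  the derivatives of the coordinate changes (and extended by 0 to everything else).
\<close>
type_synonym ('p, 'n) tangent = "('p, 'n) chart \<Rightarrow> real ^ 'n"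

text \<open>
  The tangent vector of \<open>M\<close> at \<open>p\<close> with coordinates \<open>w\<close> in the chart \<open>c\<close>. The chart \<open>c\<close> need
  not belong to the atlas of \<open>M\<close>: if \<open>c\<close> is a chart of a subdomain of \<open>M\<close>, the result is the image
  of the corresponding tangent vector under the differential of the inclusion. The derivative within
  the image of the overlap is unique, this image being relatively open in a sector.
\<close>
definition tangent_vec :: "('p, 'n::finite) manifold \<Rightarrow> ('p, 'n) chart \<Rightarrow> 'p \<Rightarrow> real ^ 'n \<Rightarrow> ('p, 'n) tangent" where
  "tangent_vec M c p w = (\<lambda>d. if d \<in> charts_at M p
     then frechet_derivative (snd d \<circ> chart_inv c) (at (snd c p) within snd c ` (fst c \<inter> fst d)) w
     else 0)"

definition tangent_space :: "('p, 'n::finite) manifold \<Rightarrow> 'p \<Rightarrow> ('p, 'n) tangent set" where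
  "tangent_space M p = {\<xi>. \<forall>c\<in>charts_at M p. \<xi> = tangent_vec M c p (\<xi> c)}"

section \<open>Finsler metrics, length and distance\<close>

type_synonym ('p, 'n) metric = "'p \<Rightarrow> ('p, 'n) tangent \<Rightarrow> real"

definition asymmetric_norm_on :: "('p, 'n::finite) tangent set \<Rightarrow> (('p, 'n) tangent \<Rightarrow> real) \<Rightarrow> bool" where
  "asymmetric_norm_on T N \<longleftrightarrow>
     (\<forall>\<xi>\<in>T. 0 \<le> N \<xi> \<and> (N \<xi> = 0 \<longleftrightarrow> \<xi> = (\<lambda>c. 0))) \<and>
     (\<forall>\<xi>\<in>T. \<forall>r\<ge>0. N (\<lambda>c. r *\<^sub>R \<xi> c) = r * N \<xi>) \<and>
     (\<forall>\<xi>\<in>T. \<forall>\<eta>\<in>T. N (\<lambda>c. \<xi> c + \<eta> c) \<le> N \<xi> + N \<eta>)"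

text \<open>Continuity on \<open>TM\<close> is continuity in the charts \<open>TU \<cong> \<phi>(U) \<times> \<real>\<^sup>n\<close> of the tangent bundle.\<close>
definition finsler_metric :: "('p, 'n::finite) manifold \<Rightarrow> ('p, 'n) metric \<Rightarrow> bool" where
  "finsler_metric M \<Phi> \<longleftrightarrow>
     (\<forall>p\<in>topspace (mtop M). asymmetric_norm_on (tangent_space M p) (\<Phi> p)) \<and>
     (\<forall>c\<in>atlas M. continuous_on ((snd c ` fst c) \<times> UNIV)
        (\<lambda>(x, w). \<Phi> (chart_inv c x) (tangent_vec M c (chart_inv c x) w)))"

definition reversible :: "('p, 'n::finite) manifold \<Rightarrow> ('p, 'n) metric \<Rightarrow> bool" where
  "reversible M \<Phi> \<longleftrightarrow>
     (\<forall>p\<in>topspace (mtop M). \<forall>\<xi>\<in>tangent_space M p. \<Phi> p (\<lambda>c. - \<xi> c) = \<Phi> p \<xi>)"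

definition C1_curve_on :: "('p, 'n::finite) manifold \<Rightarrow> real \<Rightarrow> real \<Rightarrow> (real \<Rightarrow> 'p) \<Rightarrow> bool" where
  "C1_curve_on M a b \<gamma> \<longleftrightarrow>
     continuous_map (top_of_set {a..b}) (mtop M) \<gamma> \<and>
     (\<forall>c\<in>atlas M. \<exists>\<gamma>'. continuous_on {t\<in>{a..b}. \<gamma> t \<in> fst c} \<gamma>' \<and>
        (\<forall>t\<in>{a..b}. \<gamma> t \<in> fst c \<longrightarrow>
           ((snd c \<circ> \<gamma>) has_vector_derivative \<gamma>' t) (at t within {a..b})))"

definition piecewise_C1_curve :: "('p, 'n::finite) manifold \<Rightarrow> (real \<Rightarrow> 'p) \<Rightarrow> bool" where
  "piecewise_C1_curve M \<gamma> \<longleftrightarrow>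
     (\<exists>(m::nat) s. s 0 = 0 \<and> s m = 1 \<and> (\<forall>k<m. s k < s (Suc k)) \<and>
        (\<forall>k<m. C1_curve_on M (s k) (s (Suc k)) \<gamma>))"

text \<open>Undefined at the finitely many break points, which do not matter for the length.\<close>
definition velocity :: "('p, 'n::finite) manifold \<Rightarrow> (real \<Rightarrow> 'p) \<Rightarrow> real \<Rightarrow> ('p, 'n) tangent" where
  "velocity M \<gamma> t = (\<lambda>c. if c \<in> charts_at M (\<gamma> t) then vector_derivative (snd c \<circ> \<gamma>) (at t) else 0)"

definition finsler_length :: "('p, 'n::finite) manifold \<Rightarrow> ('p, 'n) metric \<Rightarrow> (real \<Rightarrow> 'p) \<Rightarrow> ennreal" where
  "finsler_length M \<Phi> \<gamma> = (\<integral>\<^sup>+t\<in>{0..1}. ennreal (\<Phi> (\<gamma> t) (velocity M \<gamma> t)) \<partial>lborel)"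

text \<open>Points in different components have distance \<open>\<infinity>\<close>.\<close>
definition finsler_dist :: "('p, 'n::finite) manifold \<Rightarrow> ('p, 'n) metric \<Rightarrow> 'p \<Rightarrow> 'p \<Rightarrow> ennreal" where
  "finsler_dist M \<Phi> x y =
     (INF \<gamma>\<in>{\<gamma>. piecewise_C1_curve M \<gamma> \<and> \<gamma> 0 = x \<and> \<gamma> 1 = y}. finsler_length M \<Phi> \<gamma>)"

definition finsler_setdist :: "('p, 'n::finite) manifold \<Rightarrow> ('p, 'n) metric \<Rightarrow> 'p set \<Rightarrow> 'p set \<Rightarrow> ennreal" where
  "finsler_setdist M \<Phi> A B = (INF x\<in>A. INF y\<in>B. finsler_dist M \<Phi> x y)"

text \<open>The constant metric on \<open>\<real>\<^sup>n\<close>, read off in the identity chart.\<close>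
definition sup_metric :: "(real ^ 'n::finite, 'n) metric" where
  "sup_metric p \<xi> = infnorm (\<xi> (UNIV, id))"

section \<open>Finsler volumes\<close>

text \<open>
  \<open>N\<close> is a codimension zero embedded submanifold of \<open>M\<close> (for instance an open subset), and \<open>\<Psi>\<close> is
  the restriction of \<open>\<Phi>\<close> to \<open>TN\<close>.
\<close>
definition subdomain :: "('p, 'n::finite) manifold \<Rightarrow> ('p, 'n) manifold \<Rightarrow> bool" where
  "subdomain N M \<longleftrightarrow>
     topspace (mtop N) \<subseteq> topspace (mtop M) \<and>
     mtop N = subtopology (mtop M) (topspace (mtop N)) \<and>
     (\<forall>c\<in>atlas M. \<forall>d\<in>atlas N.
        smooth_on (snd d ` (fst d \<inter> fst c)) (snd c \<circ> chart_inv d) \<and>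
        smooth_on (snd c ` (fst d \<inter> fst c)) (snd d \<circ> chart_inv c))"

definition restricts_to :: "('p, 'n::finite) manifold \<Rightarrow> ('p, 'n) metric \<Rightarrow> ('p, 'n) manifold \<Rightarrow> ('p, 'n) metric \<Rightarrow> bool" where
  "restricts_to M \<Phi> N \<Psi> \<longleftrightarrow> subdomain N M \<and>
     (\<forall>p\<in>topspace (mtop N). \<forall>d\<in>charts_at N p. \<forall>w.
        \<Psi> p (tangent_vec N d p w) = \<Phi> p (tangent_vec M d p w))"

text \<open>\<open>G c p\<close> is the Gram matrix at \<open>p\<close> of the Riemannian metric in the chart \<open>c\<close>.\<close>
definition riemannian :: "('p, 'n::finite) manifold \<Rightarrow> ('p, 'n) metric \<Rightarrow> (('p, 'n) chart \<Rightarrow> 'p \<Rightarrow> real ^ 'n ^ 'n) \<Rightarrow> bool" where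
  "riemannian M \<Phi> G \<longleftrightarrow>
     (\<forall>c\<in>atlas M. smooth_on (snd c ` fst c) (G c \<circ> chart_inv c) \<and>
        (\<forall>p\<in>fst c. transpose (G c p) = G c p \<and> (\<forall>w. w \<noteq> 0 \<longrightarrow> 0 < w \<bullet> (G c p *v w)) \<and>
           (\<forall>\<xi>\<in>tangent_space M p. \<Phi> p \<xi> = sqrt (\<xi> c \<bullet> (G c p *v \<xi> c)))))"

text \<open>
  A Finsler volume is defined on the manifolds whose points are elements of the type \<open>'p\<close>. For
  \<open>'p = real ^ 'n\<close>, used as a bare set of labels of the cardinality of the continuum, every
  manifold has an isomorphic copy of this kind. Borel sets are those of the manifold topology. The
  Riemannian volume is given by its usual density in every chart, which determines it.
\<close>
definition finsler_volume :: "(('p, 'n::finite) manifold \<Rightarrow> ('p, 'n) metric \<Rightarrow> 'p measure) \<Rightarrow> bool" where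
  "finsler_volume v \<longleftrightarrow>
     (let RF = (\<lambda>M \<Phi>. smooth_manifold M \<and> finsler_metric M \<Phi> \<and> reversible M \<Phi>) in
      (\<forall>M \<Phi>. RF M \<Phi> \<longrightarrow> space (v M \<Phi>) = topspace (mtop M) \<and>
         sets (v M \<Phi>) = sigma_sets (topspace (mtop M)) {U. openin (mtop M) U}) \<and>
      (\<forall>M \<Phi> N \<Psi>. RF M \<Phi> \<longrightarrow> RF N \<Psi> \<longrightarrow> restricts_to M \<Phi> N \<Psi> \<longrightarrow>
         (\<forall>A\<in>sets (v N \<Psi>). emeasure (v N \<Psi>) A = emeasure (v M \<Phi>) A)) \<and>
      (\<forall>M \<Phi> G. RF M \<Phi> \<longrightarrow> riemannian M \<Phi> G \<longrightarrow>
         (\<forall>c\<in>atlas M. \<forall>A\<in>sets (v M \<Phi>). A \<subseteq> fst c \<longrightarrow>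
            emeasure (v M \<Phi>) A =
              (\<integral>\<^sup>+x\<in>snd c ` A. ennreal (sqrt (det (G c (chart_inv c x)))) \<partial>lborel))) \<and>
      (\<forall>M \<Phi> N \<Psi> f. RF M \<Phi> \<longrightarrow> RF N \<Psi> \<longrightarrow> f \<in> topspace (mtop M) \<rightarrow> topspace (mtop N) \<longrightarrow>
         (\<forall>x\<in>topspace (mtop M). \<forall>y\<in>topspace (mtop M).
            finsler_dist N \<Psi> (f x) (f y) \<le> finsler_dist M \<Phi> x y) \<longrightarrow>
         emeasure (v N \<Psi>) (f ` topspace (mtop M)) \<le> emeasure (v M \<Phi>) (topspace (mtop M))))"

section \<open>Parallelotopes\<close>

definition parallelotope :: "real ^ 'n \<Rightarrow> ('n::finite \<Rightarrow> real ^ 'n) \<Rightarrow> (real ^ 'n) set" where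
  "parallelotope a b = {a + (\<Sum>i\<in>UNIV. t i *\<^sub>R b i) |t. \<forall>i. t i \<in> {0..1}}"

text \<open>The pair of opposite faces with index \<open>i\<close> is given by \<open>s = 0\<close> and \<open>s = 1\<close>.\<close>
definition parallelotope_face :: "real ^ 'n \<Rightarrow> ('n::finite \<Rightarrow> real ^ 'n) \<Rightarrow> 'n \<Rightarrow> real \<Rightarrow> (real ^ 'n) set" where
  "parallelotope_face a b i s =
     {a + (\<Sum>j\<in>UNIV. t j *\<^sub>R b j) |t. (\<forall>j. t j \<in> {0..1}) \<and> t i = s}"

end

theory Submission
  imports Defs
begin

text \<open>
  Let \<open>f\<^sub>i x\<close> be the distance from \<open>x\<close> to the face \<open>F\<^sub>i\<close>. Each \<open>f\<^sub>i\<close> is 1-Lipschitz, reversibility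
  making the distance symmetric, so the map \<open>f\<close> with components \<open>f\<^sub>i\<close> is short from \<open>(P, \<Phi>)\<close> to
  \<open>\<real>\<^sup>n\<close> with the sup norm. It vanishes in the \<open>i\<close>th component on \<open>F\<^sub>i\<close> and is at least \<open>d\<^sub>i\<close> there on
  \<open>G\<^sub>i\<close>, hence \<open>f P\<close> contains the box by the Poincare-Miranda theorem, and monotonicity of the volume
  gives the inequality.
\<close>

section \<open>Smooth maps\<close>

text \<open>The metric argument leaves two gaps: \<open>f\<close> must be continuous in the
  Euclidean topology, both for the Poincare-Miranda theorem and for \<open>f P\<close> to be a Borel
  set, and the distances, which are extended reals, must be finite. Both rest on one local estimate:
  short straight segments from a point of \<open>P\<close> have small length, because \<Phi> is
  continuous in a chart and vanishes on zero vectors. The chart is taken affine, so that a segment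
  has constant coordinate velocity, and such a chart has to be built at every corner of
  \<open>P\<close>. Connectedness then spreads finiteness from small neighbourhoods to all of
  \<open>P\<close>.

  A tangent vector is a family of coordinates over all charts, and the standard atlas contains every
  diffeomorphism onto an open piece of a sector. Curves and the sup metric therefore have to be
  checked in nonlinear charts too, which is the purpose of the calculus of smooth maps. Velocities
  at break points are unspecified, so lengths are compared almost everywhere.\<close>

lemma C_k_on_subset: "C_k_on k W f \<Longrightarrow> V \<subseteq> W \<Longrightarrow> C_k_on k V f"
  by (induction k arbitrary: f) (auto intro: continuous_on_subset)

text \<open>\<open>frechet_derivative\<close> is a choice operator applied to the predicate of being
  a derivative. Functions that agree near \<open>x\<close> share this predicate, so the chosen
  values coincide even where no derivative exists.\<close>

lemma frechet_derivative_cong_open: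
  assumes "open W" "x \<in> W" "\<And>y. y \<in> W \<Longrightarrow> f y = g y"
  shows "frechet_derivative f (at x) = frechet_derivative g (at x)"
proof -
  have "(f has_derivative D) (at x) \<longleftrightarrow> (g has_derivative D) (at x)" for D
    using has_derivative_transform_within_open[OF _ assms(1,2), of f D UNIV g]
      has_derivative_transform_within_open[OF _ assms(1,2), of g D UNIV f] assms(3) by auto
  then have "(\<lambda>D. (f has_derivative D) (at x)) = (\<lambda>D. (g has_derivative D) (at x))"
    by (rule ext)
  then show "frechet_derivative f (at x) = frechet_derivative g (at x)"
    unfolding frechet_derivative_def by (rule arg_cong)
qed

lemma C_k_on_cong:
  assumes "open W" "\<And>y. y \<in> W \<Longrightarrow> f y = g y" "C_k_on k W f"
  shows "C_k_on k W g"
  using assms(2,3)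
proof (induction k arbitrary: f g)
  case 0
  then show ?case using continuous_on_cong[OF refl, of W f g] by auto
next
  case (Suc k)
  have "g differentiable (at x)" if "x \<in> W" for x
  proof -
    obtain D where "(f has_derivative D) (at x)"
      using Suc.prems(2) \<open>x \<in> W\<close> by (auto simp: differentiable_def)
    from has_derivative_transform_within_open[OF this assms(1) \<open>x \<in> W\<close> Suc.prems(1)]
    show ?thesis unfolding differentiable_def by blast
  qed
  moreover have "C_k_on k W (\<lambda>x. frechet_derivative g (at x) h)" for h
  proof (rule Suc.IH)
    show "C_k_on k W (\<lambda>x. frechet_derivative f (at x) h)" using Suc.prems by simp
    show "frechet_derivative f (at x) h = frechet_derivative g (at x) h" if "x \<in> W" for x
      using frechet_derivative_cong_open[OF assms(1) that] Suc.prems(1) by metis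
  qed
  ultimately show ?case by simp
qed

text \<open>The recursion descends through the directional derivatives to order 0, where
  differentiability gives continuity.\<close>

lemma C_k_on_Suc_imp: "C_k_on (Suc k) W f \<Longrightarrow> C_k_on k W f"
proof (induction k arbitrary: f)
  case 0
  then show ?case
    by (auto simp: continuous_on_eq_continuous_within
        intro: differentiable_imp_continuous_within differentiable_at_withinI)
next
  case (Suc k)
  from Suc.prems have "\<forall>x\<in>W. f differentiable (at x)"
    "\<And>h. C_k_on (Suc k) W (\<lambda>x. frechet_derivative f (at x) h)"
    unfolding C_k_on.simps(2)[of "Suc k"] by blast+
  then show ?case using Suc.IH by (simp only: C_k_on.simps(2)[of k W f]) blast
qed

lemma C_k_on_imp_continuous_on: "C_k_on k W f \<Longrightarrow> continuous_on W f"
  by (induction k) (auto dest: C_k_on_Suc_imp simp del: C_k_on.simps(2))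

text \<open>The derivative at a point is unique, so any explicit formula \<open>D\<close> may stand
  in for the chosen \<open>frechet_derivative\<close>. The closure properties below reduce to this
  rule.\<close>

lemma C_k_on_SucI:
  assumes "open W" "\<And>x. x \<in> W \<Longrightarrow> (f has_derivative D x) (at x)"
    "\<And>h. C_k_on k W (\<lambda>x. D x h)"
  shows "C_k_on (Suc k) W f"
proof -
  have "D x = frechet_derivative f (at x)" if "x \<in> W" for x
    using frechet_derivative_at assms(2)[OF that] by blast
  then have "C_k_on k W (\<lambda>x. frechet_derivative f (at x) h)" for h
    using C_k_on_cong[OF assms(1) _ assms(3)[of h]] by simp
  then show ?thesis using assms(2) by (auto simp: differentiable_def)
qed

lemma C_k_on_has_derivative:
  "C_k_on (Suc k) W f \<Longrightarrow> x \<in> W \<Longrightarrow> (f has_derivative frechet_derivative f (at x)) (at x)"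
  using frechet_derivative_works by auto

lemma C_k_on_const: "open W \<Longrightarrow> C_k_on k W (\<lambda>x. c)"
proof (induction k arbitrary: c)
  case (Suc k)
  then show ?case by (auto intro!: C_k_on_SucI[where D="\<lambda>x h. 0"] derivative_eq_intros simp del: C_k_on.simps(2))
qed simp

lemma C_k_on_affine:
  assumes "open W" "bounded_linear f"
  shows "C_k_on k W (\<lambda>x. f x + c)"
proof (cases k)
  case 0
  then show ?thesis using linear_continuous_on[OF assms(2)] by (auto intro!: continuous_on_add continuous_on_const)
next
  case (Suc j)
  have "((\<lambda>x. f x + c) has_derivative f) (at x)" for x
    by (auto intro!: derivative_eq_intros bounded_linear_imp_has_derivative assms)
  then show ?thesis unfolding Suc
    by (intro C_k_on_SucI[where D="\<lambda>x. f"]) (auto intro: C_k_on_const assms)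
qed

lemma C_k_on_bounded_linear:
  assumes "open W" "bounded_linear l"
  shows "C_k_on k W f \<Longrightarrow> C_k_on k W (\<lambda>x. l (f x))"
proof (induction k arbitrary: f)
  case 0
  then show ?case using bounded_linear.continuous_on[OF assms(2)] by simp
next
  case (Suc k)
  show ?case
  proof (rule C_k_on_SucI[OF assms(1)])
    show "((\<lambda>x. l (f x)) has_derivative (\<lambda>h. l (frechet_derivative f (at x) h))) (at x)" if "x \<in> W" for x
      by (rule bounded_linear.has_derivative[OF assms(2) C_k_on_has_derivative[OF Suc.prems that]])
  qed (use Suc in simp)
qed

lemma C_k_on_add:
  assumes "open W"
  shows "C_k_on k W f \<Longrightarrow> C_k_on k W g \<Longrightarrow> C_k_on k W (\<lambda>x. f x + g x)"
proof (induction k arbitrary: f g)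
  case 0
  then show ?case by (auto intro: continuous_intros)
next
  case (Suc k)
  show ?case
  proof (rule C_k_on_SucI[OF assms(1)])
    show "((\<lambda>x. f x + g x) has_derivative
        (\<lambda>h. frechet_derivative f (at x) h + frechet_derivative g (at x) h)) (at x)" if "x \<in> W" for x
      by (intro has_derivative_add C_k_on_has_derivative[OF Suc.prems(1) that] C_k_on_has_derivative[OF Suc.prems(2) that])
  qed (use Suc in simp)
qed

lemma C_k_on_sum:
  assumes "open W" "\<And>i. i \<in> I \<Longrightarrow> C_k_on k W (f i)"
  shows "C_k_on k W (\<lambda>x. \<Sum>i\<in>I. f i x)"
  using assms(2) by (induction I rule: infinite_finite_induct) (auto intro: C_k_on_const C_k_on_add assms(1))

lemma C_k_on_scaleR:
  assumes "open W"
  shows "C_k_on k W f \<Longrightarrow> C_k_on k W g \<Longrightarrow> C_k_on k W (\<lambda>x. f x *\<^sub>R g x)"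
proof (induction k arbitrary: f g)
  case 0
  then show ?case by (auto intro: continuous_intros)
next
  case (Suc k)
  show ?case
  proof (rule C_k_on_SucI[OF assms(1)])
    show "((\<lambda>x. f x *\<^sub>R g x) has_derivative
        (\<lambda>h. f x *\<^sub>R frechet_derivative g (at x) h + frechet_derivative f (at x) h *\<^sub>R g x)) (at x)" if "x \<in> W" for x
      by (intro has_derivative_scaleR C_k_on_has_derivative[OF Suc.prems(1) that] C_k_on_has_derivative[OF Suc.prems(2) that])
    show "C_k_on k W (\<lambda>x. f x *\<^sub>R frechet_derivative g (at x) h + frechet_derivative f (at x) h *\<^sub>R g x)" for h
      using Suc.prems C_k_on_Suc_imp[OF Suc.prems(1)] C_k_on_Suc_imp[OF Suc.prems(2)]
      by (intro C_k_on_add assms Suc.IH) simp_all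
  qed
qed

lemma linear_eq_sum_Basis:
  fixes f :: "'a::euclidean_space \<Rightarrow> 'b::real_vector"
  assumes "linear f"
  shows "f h = (\<Sum>i\<in>Basis. (h \<bullet> i) *\<^sub>R f i)"
  by (metis (mono_tags, lifting) assms euclidean_representation linear_scale linear_sum sum.cong)

text \<open>In the chain rule term \<open>?G (f x) (?F x h)\<close> the point \<open>x\<close>
  enters both the linear map and its argument. Expanding the argument in a basis separates the two:
  for a fixed \<open>i\<close>, the factor \<open>?G (f x) i\<close> is again a composition with
  \<open>f\<close>, to which the induction hypothesis applies. Hence the induction generalizes over
  \<open>g\<close>.\<close>

lemma C_k_on_compose:
  fixes f :: "'a::real_normed_vector \<Rightarrow> 'b::euclidean_space" and g :: "'b \<Rightarrow> 'c::real_normed_vector"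
  assumes "open W" "open V" "f ` W \<subseteq> V"
  shows "C_k_on k W f \<Longrightarrow> C_k_on k V g \<Longrightarrow> C_k_on k W (\<lambda>x. g (f x))"
proof (induction k arbitrary: g)
  case 0
  then show ?case using assms(3) by (auto intro: continuous_on_compose2)
next
  case (Suc k)
  let ?F = "\<lambda>x. frechet_derivative f (at x)" and ?G = "\<lambda>y. frechet_derivative g (at y)"
  show ?case
  proof (rule C_k_on_SucI[OF assms(1)])
    fix x assume x: "x \<in> W"
    have g: "(g has_derivative ?G (f x)) (at (f x))"
      using C_k_on_has_derivative[OF Suc.prems(2)] x assms(3) by blast
    have "((\<lambda>x. g (f x)) has_derivative (\<lambda>h. ?G (f x) (?F x h))) (at x)"
      using has_derivative_compose[OF C_k_on_has_derivative[OF Suc.prems(1) x] g] .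
    also have "(\<lambda>h. ?G (f x) (?F x h)) = (\<lambda>h. \<Sum>i\<in>Basis. (?F x h \<bullet> i) *\<^sub>R ?G (f x) i)"
      using linear_eq_sum_Basis[OF has_derivative_linear[OF g]] by blast
    finally show "((\<lambda>x. g (f x)) has_derivative (\<lambda>h. \<Sum>i\<in>Basis. (?F x h \<bullet> i) *\<^sub>R ?G (f x) i)) (at x)" .
  next
    fix h
    show "C_k_on k W (\<lambda>x. \<Sum>i\<in>Basis. (?F x h \<bullet> i) *\<^sub>R ?G (f x) i)"
    proof (rule C_k_on_sum[OF assms(1)], rule C_k_on_scaleR[OF assms(1)])
      fix i :: 'b
      show "C_k_on k W (\<lambda>x. ?F x h \<bullet> i)"
        by (rule C_k_on_bounded_linear[OF assms(1) bounded_linear_inner_left]) (use Suc.prems(1) in simp)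
      show "C_k_on k W (\<lambda>x. ?G (f x) i)"
        by (rule Suc.IH[OF C_k_on_Suc_imp[OF Suc.prems(1)]]) (use Suc.prems(2) in simp)
    qed
  qed
qed

section \<open>Smoothness on arbitrary sets through local extensions\<close>

lemma smooth_onE:
  assumes "smooth_on S f" "x \<in> S"
  obtains W g where "open W" "x \<in> W" "\<forall>k. C_k_on k W g" "\<forall>y\<in>S \<inter> W. g y = f y"
  using bspec[OF assms(1)[unfolded smooth_on_def] assms(2)] by (elim exE conjE)

lemma smooth_onI:
  assumes "\<And>x. x \<in> S \<Longrightarrow> \<exists>W g. open W \<and> x \<in> W \<and> (\<forall>k. C_k_on k W g) \<and> (\<forall>y\<in>S \<inter> W. g y = f y)"
  shows "smooth_on S f"
  unfolding smooth_on_def using assms by (rule ballI)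

lemma smooth_on_subset:
  assumes "smooth_on S f" "T \<subseteq> S" shows "smooth_on T f"
proof (rule smooth_onI)
  fix x assume "x \<in> T"
  then have "x \<in> S" using assms by auto
  with assms(1) obtain W g where "open W" "x \<in> W" "\<forall>k. C_k_on k W g" "\<forall>y\<in>S \<inter> W. g y = f y"
    by (rule smooth_onE)
  then show "\<exists>W g. open W \<and> x \<in> W \<and> (\<forall>k. C_k_on k W g) \<and> (\<forall>y\<in>T \<inter> W. g y = f y)"
    using assms(2) by (intro exI[of _ W] exI[of _ g]) (auto simp del: C_k_on.simps)
qed

lemma smooth_on_cong:
  assumes "smooth_on S f" "\<And>x. x \<in> S \<Longrightarrow> f x = g x"
  shows "smooth_on S g"
  using assms unfolding smooth_on_def by (simp del: C_k_on.simps)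

lemma smooth_on_affine: "bounded_linear f \<Longrightarrow> smooth_on S (\<lambda>x. f x + c)"
  by (intro smooth_onI exI[of _ UNIV] exI[of _ "\<lambda>x. f x + c"]) (auto intro: C_k_on_affine simp del: C_k_on.simps)

lemma smooth_on_imp_continuous_on:
  assumes "smooth_on S f" shows "continuous_on S f"
  unfolding continuous_on_eq_continuous_within
proof
  fix x assume x: "x \<in> S"
  with assms obtain W g where W: "open W" "x \<in> W" "\<forall>k. C_k_on k W g"
    "\<forall>y\<in>S \<inter> W. g y = f y"
    by (rule smooth_onE)
  then have "continuous (at x within S) g"
    by (metis W(1) C_k_on_imp_continuous_on[OF spec[OF W(3)]] continuous_at_imp_continuous_at_within continuous_on_eq_continuous_at)
  then show "continuous (at x within S) f"
    using W x continuous_transform_within_openin[of x S g "S \<inter> W" f]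
    by (simp add: openin_open_Int)
qed

lemma smooth_on_compose:
  fixes f :: "'a::real_normed_vector \<Rightarrow> 'b::euclidean_space" and g :: "'b \<Rightarrow> 'c::real_normed_vector"
  assumes "smooth_on S f" "smooth_on T g" "f ` S \<subseteq> T"
  shows "smooth_on S (g \<circ> f)"
proof (rule smooth_onI)
  fix x assume x: "x \<in> S"
  with assms(1) obtain W f' where f: "open W" "x \<in> W" "\<forall>k. C_k_on k W f'"
    "\<forall>y\<in>S \<inter> W. f' y = f y"
    by (rule smooth_onE)
  have "f x \<in> T" using x assms by auto
  with assms(2) obtain V g' where g: "open V" "f x \<in> V" "\<forall>k. C_k_on k V g'"
    "\<forall>y\<in>T \<inter> V. g' y = g y"
    by (rule smooth_onE)
  \<comment> \<open>The extension \<open>f'\<close> may leave \<open>V\<close> away from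
    \<open>x\<close>; its continuity on \<open>W\<close> makes the part that stays in
    \<open>V\<close> an open neighbourhood of \<open>x\<close>.\<close>
  define U where "U = W \<inter> f' -` V"
  have "open U" unfolding U_def
    by (rule continuous_open_preimage[OF C_k_on_imp_continuous_on[OF spec[OF f(3)]] f(1) g(1)])
  moreover have "x \<in> U" using f g x by (auto simp: U_def)
  moreover have "C_k_on k U (\<lambda>x. g' (f' x))" for k
    by (rule C_k_on_compose[OF \<open>open U\<close> g(1) _ C_k_on_subset[OF spec[OF f(3)]] spec[OF g(3)]]) (auto simp: U_def)
  moreover have "\<forall>y\<in>S \<inter> U. g' (f' y) = (g \<circ> f) y"
    using f(4) g(4) assms(3) by (auto simp: U_def)
  ultimately show "\<exists>W h. open W \<and> x \<in> W \<and> (\<forall>k. C_k_on k W h) \<and> (\<forall>y\<in>S \<inter> W. h y = (g \<circ> f) y)"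
    by (intro exI[of _ U] exI[of _ "\<lambda>x. g' (f' x)"] conjI) (simp_all del: C_k_on.simps)
qed

section \<open>Charts and velocities\<close>

lemma smooth_on_imp_differentiable:
  assumes "smooth_on S f" "x \<in> S"
  shows "f differentiable (at x within S)"
proof -
  obtain W g where W: "open W" "x \<in> W" "\<forall>k. C_k_on k W g" "\<forall>y\<in>S \<inter> W. g y = f y"
    using assms by (rule smooth_onE)
  have "(g has_derivative frechet_derivative g (at x)) (at x within S \<inter> W)"
    using C_k_on_has_derivative[OF spec[OF W(3)] W(2)] by (rule has_derivative_at_withinI)
  then have "(f has_derivative frechet_derivative g (at x)) (at x within S \<inter> W)"
    by (rule has_derivative_transform_within[where d=1]) (use W assms(2) in auto)
  then have "(f has_derivative frechet_derivative g (at x)) (at x within S)"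
    using at_within_nhd[OF W(2,1), of S "S \<inter> W"] by auto
  then show ?thesis by (auto simp: differentiable_def)
qed

text \<open>Adding a positive multiple of an axis vector never leaves a sector. So even at a corner
  every coordinate direction can be approached from one side inside \<open>S\<close>, and this
  determines the derivative.\<close>

lemma has_derivative_unique_sector:
  fixes f :: "real ^ 'n \<Rightarrow> 'b::real_normed_vector"
  assumes "openin (top_of_set (sector I)) S" "x \<in> S"
    and "(f has_derivative A) (at x within S)" "(f has_derivative B) (at x within S)"
  shows "A = B"
proof (rule frechet_derivative_unique_within[OF assms(3,4)])
  fix i :: "real ^ 'n" and e :: real assume "i \<in> Basis" "0 < e"
  then obtain j where i: "i = axis j 1" by (auto simp: Basis_vec_def)
  obtain r where r: "0 < r" "ball x r \<inter> sector I \<subseteq> S" "S \<subseteq> sector I"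
    using assms(1,2) unfolding openin_contains_ball by blast
  define s where "s = min r e / 2"
  have s: "0 < s" "s < r" "s < e" using r \<open>0 < e\<close> by (auto simp: s_def min_def)
  have "x + s *\<^sub>R i \<in> sector I"
    using r(3) assms(2) s(1) by (fastforce simp: sector_def i axis_def)
  moreover have "x + s *\<^sub>R i \<in> ball x r" using s by (simp add: dist_norm i norm_axis_1)
  ultimately show "\<exists>d. 0 < \<bar>d\<bar> \<and> \<bar>d\<bar> < e \<and> x + d *\<^sub>R i \<in> S"
    using s r by (intro exI[of _ s]) auto
qed

section \<open>Charts, tangent spaces and homogeneity of the metric\<close>

lemma atlas_openin: "smooth_manifold M \<Longrightarrow> c \<in> atlas M \<Longrightarrow> openin (mtop M) (fst c)"
  by (auto simp: smooth_manifold_def)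

lemma atlas_inj_on:
  assumes "smooth_manifold M" "c \<in> atlas M"
  shows "inj_on (snd c) (fst c)"
proof -
  have "homeomorphic_map (subtopology (mtop M) (fst c)) (top_of_set (snd c ` fst c)) (snd c)"
    using assms by (auto simp: smooth_manifold_def)
  from homeomorphic_imp_injective_map[OF this] show ?thesis
    using openin_subset[OF atlas_openin[OF assms]] by (simp add: inf_absorb2)
qed

lemma chart_inv_eq:
  "inj_on (snd c) (fst c) \<Longrightarrow> p \<in> fst c \<Longrightarrow> chart_inv c (snd c p) = p"
  by (simp add: chart_inv_def)

lemma chart_inv_works:
  "x \<in> snd c ` fst c \<Longrightarrow> chart_inv c x \<in> fst c \<and> snd c (chart_inv c x) = x"
  by (simp add: chart_inv_def inv_into_into f_inv_into_f)

lemma charts_at_nonempty: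
  "smooth_manifold M \<Longrightarrow> p \<in> topspace (mtop M) \<Longrightarrow> \<exists>c. c \<in> charts_at M p"
  unfolding smooth_manifold_def charts_at_def by blast

lemma has_derivative_tangent_vec:
  assumes M: "smooth_manifold M" and c: "c \<in> charts_at M p" and d: "d \<in> charts_at M p"
  shows "((snd d \<circ> chart_inv c) has_derivative (\<lambda>w. tangent_vec M c p w d))
    (at (snd c p) within snd c ` (fst c \<inter> fst d))"
proof -
  have "smooth_on (snd c ` (fst c \<inter> fst d)) (snd d \<circ> chart_inv c)"
    using assms by (auto simp: smooth_manifold_def charts_at_def)
  then have "(snd d \<circ> chart_inv c) differentiable (at (snd c p) within snd c ` (fst c \<inter> fst d))"
    by (rule smooth_on_imp_differentiable) (use c d in \<open>auto simp: charts_at_def\<close>)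
  then show ?thesis using d unfolding frechet_derivative_works by (simp add: tangent_vec_def)
qed

lemma linear_tangent_vec:
  assumes M: "smooth_manifold M" and c: "c \<in> charts_at M p"
  shows "linear (\<lambda>w. tangent_vec M c p w d)"
proof (cases "d \<in> charts_at M p")
  case True
  from has_derivative_linear[OF has_derivative_tangent_vec[OF M c this]] show ?thesis .
next
  case False
  then show ?thesis by (simp add: tangent_vec_def linear_iff)
qed

lemma tangent_vec_0:
  assumes "smooth_manifold M" "c \<in> charts_at M p"
  shows "tangent_vec M c p 0 = (\<lambda>d. 0)"
  using linear_0[OF linear_tangent_vec[OF assms]] by auto

lemma tangent_space_scaleR:
  assumes "smooth_manifold M" "\<xi> \<in> tangent_space M p"
  shows "(\<lambda>c. r *\<^sub>R \<xi> c) \<in> tangent_space M p"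
  unfolding tangent_space_def
proof (rule CollectI, rule ballI, rule ext)
  fix c d assume c: "c \<in> charts_at M p"
  have "\<xi> d = tangent_vec M c p (\<xi> c) d"
    using assms(2) c unfolding tangent_space_def by simp
  then show "r *\<^sub>R \<xi> d = tangent_vec M c p (r *\<^sub>R \<xi> c) d"
    using linear_scale[OF linear_tangent_vec[OF assms(1) c, of d], of r "\<xi> c"] by simp
qed

text \<open>Reversibility extends positive homogeneity to negative factors, which occur for curves
  run backwards.\<close>

lemma finsler_metric_scaleR:
  assumes "smooth_manifold M" "finsler_metric M \<Phi>" "reversible M \<Phi>"
    and "p \<in> topspace (mtop M)" "\<xi> \<in> tangent_space M p"
  shows "\<Phi> p (\<lambda>c. r *\<^sub>R \<xi> c) = \<bar>r\<bar> * \<Phi> p \<xi>"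
proof -
  have *: "\<Phi> p (\<lambda>c. s *\<^sub>R \<xi> c) = s * \<Phi> p \<xi>" if "0 \<le> s" for s
    using assms that unfolding finsler_metric_def asymmetric_norm_on_def by blast
  show ?thesis
  proof (cases "0 \<le> r")
    case False
    have "\<Phi> p (\<lambda>c. - (\<bar>r\<bar> *\<^sub>R \<xi> c)) = \<Phi> p (\<lambda>c. \<bar>r\<bar> *\<^sub>R \<xi> c)"
      using assms(3,4) tangent_space_scaleR[OF assms(1,5), of "\<bar>r\<bar>"] unfolding reversible_def by auto
    then show ?thesis using *[of "\<bar>r\<bar>"] False by simp
  qed (use * in simp)
qed

section \<open>Velocity and speed of smooth curves\<close>

lemma C1_curve_on_topspace:
  "C1_curve_on M a b \<gamma> \<Longrightarrow> t \<in> {a..b} \<Longrightarrow> \<gamma> t \<in> topspace (mtop M)"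
  unfolding C1_curve_on_def continuous_map_def by auto

lemma C1_curve_on_open_preimage:
  assumes "C1_curve_on M a b \<gamma>" "openin (mtop M) U"
  shows "open {t\<in>{a<..<b}. \<gamma> t \<in> U}"
proof -
  have "openin (top_of_set {a..b}) {t \<in> {a..b}. \<gamma> t \<in> U}"
    using openin_continuous_map_preimage[of "top_of_set {a..b}" "mtop M" \<gamma> U] assms
    by (simp add: C1_curve_on_def)
  then obtain V where V: "open V" "{t \<in> {a..b}. \<gamma> t \<in> U} = {a..b} \<inter> V"
    by (auto simp: openin_open)
  have "{t\<in>{a<..<b}. \<gamma> t \<in> U} = {a<..<b} \<inter> {t \<in> {a..b}. \<gamma> t \<in> U}" by auto
  also have "\<dots> = {a<..<b} \<inter> V" unfolding V(2) by auto
  finally show ?thesis using V(1) by (simp add: open_Int)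
qed

lemma C1_curve_on_velocity:
  assumes "C1_curve_on M a b \<gamma>" "t \<in> {a<..<b}" "c \<in> charts_at M (\<gamma> t)"
  shows "((snd c \<circ> \<gamma>) has_vector_derivative velocity M \<gamma> t c) (at t)"
proof -
  obtain v where "((snd c \<circ> \<gamma>) has_vector_derivative v) (at t within {a..b})"
    using assms unfolding C1_curve_on_def charts_at_def by fastforce
  then have "((snd c \<circ> \<gamma>) has_vector_derivative v) (at t)"
    using assms(2) at_within_interior[of t "{a..b}"] by auto
  then show ?thesis using assms(3) vector_derivative_at by (metis velocity_def)
qed

text \<open>This is the chain rule for the coordinate change from \<open>c\<close> to
  \<open>d\<close>. It makes the coordinate velocities a genuine tangent vector, so that the axioms
  of the metric apply to them.\<close>

lemma velocity_eq_tangent_vec: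
  assumes M: "smooth_manifold M" and \<gamma>: "C1_curve_on M a b \<gamma>" and t: "t \<in> {a<..<b}"
    and c: "c \<in> charts_at M (\<gamma> t)"
  shows "velocity M \<gamma> t = tangent_vec M c (\<gamma> t) (velocity M \<gamma> t c)"
proof
  fix d
  show "velocity M \<gamma> t d = tangent_vec M c (\<gamma> t) (velocity M \<gamma> t c) d"
  proof (cases "d \<in> charts_at M (\<gamma> t)")
    case False
    then show ?thesis by (simp add: velocity_def tangent_vec_def)
  next
    case True
    \<comment> \<open>The coordinate change is differentiated within the image of the overlap, so
      time is restricted to where the curve stays in both chart domains. This set is open, so the
      derivative within it is the full derivative at \<open>t\<close>.\<close>
    define U where "U = {s\<in>{a<..<b}. \<gamma> s \<in> fst c \<inter> fst d}"
    have "open U"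
      unfolding U_def using c True by (intro C1_curve_on_open_preimage[OF \<gamma>] openin_Int atlas_openin[OF M]) (auto simp: charts_at_def)
    have tU: "t \<in> U" using t c True by (auto simp: U_def charts_at_def)
    let ?v = "velocity M \<gamma> t c"
    have "((snd c \<circ> \<gamma>) has_derivative (\<lambda>h. h *\<^sub>R ?v)) (at t within U)"
      using C1_curve_on_velocity[OF \<gamma> t c] unfolding has_vector_derivative_def
      by (rule has_derivative_at_withinI)
    moreover have "((snd d \<circ> chart_inv c) has_derivative (\<lambda>w. tangent_vec M c (\<gamma> t) w d))
        (at ((snd c \<circ> \<gamma>) t) within (snd c \<circ> \<gamma>) ` U)"
      using has_derivative_tangent_vec[OF M c True] unfolding comp_apply
      by (rule has_derivative_subset) (auto simp: U_def)
    ultimately have "((snd d \<circ> chart_inv c) \<circ> (snd c \<circ> \<gamma>) has_derivative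
        (\<lambda>w. tangent_vec M c (\<gamma> t) w d) \<circ> (\<lambda>h. h *\<^sub>R ?v)) (at t within U)"
      by (rule diff_chain_within)
    moreover have "(\<lambda>w. tangent_vec M c (\<gamma> t) w d) \<circ> (\<lambda>h. h *\<^sub>R ?v)
        = (\<lambda>h. h *\<^sub>R tangent_vec M c (\<gamma> t) ?v d)"
      using linear_scale[OF linear_tangent_vec[OF M c, of d]] by (simp add: o_def)
    ultimately have "((snd d \<circ> chart_inv c) \<circ> (snd c \<circ> \<gamma>) has_derivative
        (\<lambda>h. h *\<^sub>R tangent_vec M c (\<gamma> t) ?v d)) (at t)"
      using at_within_open[OF tU \<open>open U\<close>] by simp
    then have "((snd d \<circ> \<gamma>) has_derivative (\<lambda>h. h *\<^sub>R tangent_vec M c (\<gamma> t) ?v d)) (at t)"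
    proof (rule has_derivative_transform_within_open[OF _ \<open>open U\<close> tU])
      fix s assume "s \<in> U"
      then show "((snd d \<circ> chart_inv c) \<circ> (snd c \<circ> \<gamma>)) s = (snd d \<circ> \<gamma>) s"
        using c chart_inv_eq[OF atlas_inj_on[OF M]] by (auto simp: U_def charts_at_def)
    qed
    then have "((snd d \<circ> \<gamma>) has_vector_derivative tangent_vec M c (\<gamma> t) ?v d) (at t)"
      by (simp add: has_vector_derivative_def)
    with C1_curve_on_velocity[OF \<gamma> t True] show ?thesis
      using vector_derivative_at by metis
  qed
qed

lemma velocity_in_tangent_space:
  assumes "smooth_manifold M" "C1_curve_on M a b \<gamma>" "t \<in> {a<..<b}"
  shows "velocity M \<gamma> t \<in> tangent_space M (\<gamma> t)"
  using velocity_eq_tangent_vec[OF assms] by (auto simp: tangent_space_def)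


text \<open>In one chart the speed is the coordinate expression of the metric composed with the pair
  \<open>(snd c (\<gamma> t), \<gamma>' t)\<close>, and the parameter sets belonging to the charts
  form an open cover. The endpoints are left out because \<open>velocity\<close> takes the two-sided
  derivative, which need not exist there.\<close>

lemma continuous_on_speed:
  assumes M: "smooth_manifold M" and \<Phi>: "finsler_metric M \<Phi>" and \<gamma>: "C1_curve_on M a b \<gamma>"
  shows "continuous_on {a<..<b} (\<lambda>t. \<Phi> (\<gamma> t) (velocity M \<gamma> t))"
proof -
  have "continuous_on U (\<lambda>t. \<Phi> (\<gamma> t) (velocity M \<gamma> t))"
    if c: "c \<in> atlas M" and U: "U = {s\<in>{a<..<b}. \<gamma> s \<in> fst c}" for c U
  proof -
    obtain \<gamma>' where \<gamma>': "continuous_on {t\<in>{a..b}. \<gamma> t \<in> fst c} \<gamma>'"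
      "\<And>t. t \<in> {a..b} \<Longrightarrow> \<gamma> t \<in> fst c \<Longrightarrow> ((snd c \<circ> \<gamma>) has_vector_derivative \<gamma>' t) (at t within {a..b})"
      using \<gamma> c unfolding C1_curve_on_def by blast
    have cat: "c \<in> charts_at M (\<gamma> t)" if "t \<in> U" for t
      using that c U by (auto simp: charts_at_def)
    have v: "velocity M \<gamma> t c = \<gamma>' t" if "t \<in> U" for t
    proof -
      have "((snd c \<circ> \<gamma>) has_vector_derivative \<gamma>' t) (at t)"
        using \<gamma>'(2)[of t] that at_within_interior[of t "{a..b}"] by (auto simp: U)
      then show ?thesis using cat[OF that] vector_derivative_at by (auto simp: velocity_def)
    qed
    have "continuous_on U (snd c \<circ> \<gamma>)"
    proof (rule continuous_at_imp_continuous_on, rule ballI)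
      fix t assume "t \<in> U"
      then show "isCont (snd c \<circ> \<gamma>) t"
        using has_vector_derivative_continuous[OF C1_curve_on_velocity[OF \<gamma> _ cat]] U by blast
    qed
    then have pair: "continuous_on U (\<lambda>t. (snd c (\<gamma> t), \<gamma>' t))"
      by (intro continuous_on_Pair continuous_on_subset[OF \<gamma>'(1)]) (auto simp: U o_def)
    have metric: "continuous_on ((snd c ` fst c) \<times> UNIV)
        (\<lambda>(x, w). \<Phi> (chart_inv c x) (tangent_vec M c (chart_inv c x) w))"
      using \<Phi> c unfolding finsler_metric_def by blast
    have "continuous_on U (\<lambda>t. (\<lambda>(x, w). \<Phi> (chart_inv c x) (tangent_vec M c (chart_inv c x) w))
        (snd c (\<gamma> t), \<gamma>' t))"
      by (rule continuous_on_compose2[OF metric pair]) (auto simp: U)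
    then show ?thesis
    proof (rule continuous_on_eq)
      fix t assume t: "t \<in> U"
      have inv: "chart_inv c (snd c (\<gamma> t)) = \<gamma> t"
        using t by (intro chart_inv_eq[OF atlas_inj_on[OF M c]]) (auto simp: U)
      have "velocity M \<gamma> t = tangent_vec M c (\<gamma> t) (\<gamma>' t)"
        using velocity_eq_tangent_vec[OF M \<gamma> _ cat[OF t]] t unfolding v[OF t] U by blast
      then show "(\<lambda>(x, w). \<Phi> (chart_inv c x) (tangent_vec M c (chart_inv c x) w)) (snd c (\<gamma> t), \<gamma>' t)
          = \<Phi> (\<gamma> t) (velocity M \<gamma> t)"
        by (simp add: inv)
    qed
  qed
  then have "continuous_on (\<Union>c\<in>atlas M. {s\<in>{a<..<b}. \<gamma> s \<in> fst c}) (\<lambda>t. \<Phi> (\<gamma> t) (velocity M \<gamma> t))"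
    by (intro continuous_on_open_UN C1_curve_on_open_preimage[OF \<gamma>] atlas_openin[OF M]) auto
  moreover have "(\<Union>c\<in>atlas M. {s\<in>{a<..<b}. \<gamma> s \<in> fst c}) = {a<..<b}"
  proof safe
    fix t assume t: "t \<in> {a<..<b}"
    then obtain c where "c \<in> charts_at M (\<gamma> t)"
      using charts_at_nonempty[OF M C1_curve_on_topspace[OF \<gamma>, of t]] by auto
    with t show "t \<in> (\<Union>c\<in>atlas M. {s\<in>{a<..<b}. \<gamma> s \<in> fst c})"
      by (auto simp: charts_at_def)
  qed
  ultimately show ?thesis by simp
qed

section \<open>Length of piecewise smooth curves\<close>

text \<open>An inductive form of the partitions in \<open>piecewise_C1_curve\<close>, on arbitrary
  intervals so that it covers parts and reparametrizations of a curve and allows induction over the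
  pieces.\<close>

inductive pw_C1 :: "('p, 'n::finite) manifold \<Rightarrow> (real \<Rightarrow> 'p) \<Rightarrow> real \<Rightarrow> real \<Rightarrow> bool"
  for M \<gamma> where
  piece: "a < b \<Longrightarrow> C1_curve_on M a b \<gamma> \<Longrightarrow> pw_C1 M \<gamma> a b"
| snoc: "pw_C1 M \<gamma> a b \<Longrightarrow> b < c \<Longrightarrow> C1_curve_on M b c \<gamma> \<Longrightarrow> pw_C1 M \<gamma> a c"

lemma pw_C1_less: "pw_C1 M \<gamma> a b \<Longrightarrow> a < b"
  by (induction rule: pw_C1.induct) auto

lemma pw_C1_trans: "pw_C1 M \<gamma> b c \<Longrightarrow> pw_C1 M \<gamma> a b \<Longrightarrow> pw_C1 M \<gamma> a c"
  by (induction rule: pw_C1.induct) (auto intro: pw_C1.snoc)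

lemma pw_C1_imp_partition:
  assumes "pw_C1 M \<gamma> a b"
  shows "\<exists>(m::nat) s. s 0 = a \<and> s m = b \<and> (\<forall>k<m. s k < s (Suc k)) \<and>
    (\<forall>k<m. C1_curve_on M (s k) (s (Suc k)) \<gamma>)"
  using assms
proof induction
  case (piece a b)
  then show ?case by (intro exI[of _ 1] exI[of _ "\<lambda>k. if k = 0 then a else b"]) auto
next
  case (snoc a b c)
  then obtain m :: nat and s where s: "s 0 = a" "s m = b" "\<forall>k<m. s k < s (Suc k)"
    "\<forall>k<m. C1_curve_on M (s k) (s (Suc k)) \<gamma>" by (elim exE conjE)
  show ?case
    by (intro exI[of _ "Suc m"] exI[of _ "s(Suc m := c)"])
      (use s snoc.hyps in \<open>auto simp: less_Suc_eq\<close>)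
qed

lemma partition_imp_pw_C1:
  assumes "\<forall>k<m. s k < s (Suc k)" "\<forall>k<m. C1_curve_on M (s k) (s (Suc k)) \<gamma>"
  shows "k < m \<Longrightarrow> pw_C1 M \<gamma> (s 0) (s (Suc k))"
proof (induction k)
  case 0
  then show ?case using assms by (intro pw_C1.piece) auto
next
  case (Suc k)
  show ?case by (rule pw_C1.snoc[OF Suc.IH]) (use Suc.prems assms in auto)
qed

lemma piecewise_C1_curve_iff: "piecewise_C1_curve M \<gamma> \<longleftrightarrow> pw_C1 M \<gamma> 0 1"
proof
  assume "piecewise_C1_curve M \<gamma>"
  then obtain m :: nat and s where s: "s 0 = 0" "s m = 1" "\<forall>k<m. s k < s (Suc k)"
    "\<forall>k<m. C1_curve_on M (s k) (s (Suc k)) \<gamma>"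
    unfolding piecewise_C1_curve_def by (elim exE conjE)
  then have "m \<noteq> 0" by (cases m) auto
  then obtain k where "m = Suc k" by (cases m) auto
  then show "pw_C1 M \<gamma> 0 1" using partition_imp_pw_C1[OF s(3,4), of k] s(1,2) by simp
qed (auto dest: pw_C1_imp_partition simp: piecewise_C1_curve_def)

definition speed :: "('p, 'n::finite) manifold \<Rightarrow> ('p, 'n) metric \<Rightarrow> (real \<Rightarrow> 'p) \<Rightarrow> real \<Rightarrow> ennreal" where
  "speed M \<Phi> \<gamma> t = ennreal (\<Phi> (\<gamma> t) (velocity M \<gamma> t))"

definition seg_length :: "('p, 'n::finite) manifold \<Rightarrow> ('p, 'n) metric \<Rightarrow> (real \<Rightarrow> 'p) \<Rightarrow> real \<Rightarrow> real \<Rightarrow> ennreal" where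
  "seg_length M \<Phi> \<gamma> a b = (\<integral>\<^sup>+t\<in>{a..b}. speed M \<Phi> \<gamma> t \<partial>lborel)"

lemma finsler_length_eq: "finsler_length M \<Phi> \<gamma> = seg_length M \<Phi> \<gamma> 0 1"
  by (simp add: finsler_length_def seg_length_def speed_def)

lemma AE_not_two: "AE t in lborel. t \<noteq> (a::real) \<and> t \<noteq> b"
  using AE_lborel_singleton[of a] AE_lborel_singleton[of b] by eventually_elim auto

text \<open>Continuity holds on the open interval only; the values at \<open>a\<close> and
  \<open>b\<close> are unspecified and are patched in as constants.\<close>

lemma C1_speed_measurable:
  assumes M: "smooth_manifold M" and \<Phi>: "finsler_metric M \<Phi>" and \<gamma>: "C1_curve_on M a b \<gamma>"
  shows "(\<lambda>t. speed M \<Phi> \<gamma> t * indicator {a..b} t) \<in> borel_measurable borel"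
proof -
  let ?f = "\<lambda>t. \<Phi> (\<gamma> t) (velocity M \<gamma> t)"
  have f: "(\<lambda>t. indicator {a<..<b} t *\<^sub>R ?f t) \<in> borel_measurable borel"
    by (rule borel_measurable_continuous_on_indicator[OF _ continuous_on_speed[OF M \<Phi> \<gamma>]]) simp
  have "(\<lambda>t. speed M \<Phi> \<gamma> t * indicator {a..b} t)
    = (\<lambda>t. if t = a then speed M \<Phi> \<gamma> a * indicator {a..b} a else
          if t = b then speed M \<Phi> \<gamma> b * indicator {a..b} b else ennreal (indicator {a<..<b} t *\<^sub>R ?f t))"
  proof
    fix t
    consider "t = a" | "t = b" "t \<noteq> a" | "t \<in> {a<..<b}" | "t \<notin> {a..b}" by fastforce
    then show "speed M \<Phi> \<gamma> t * indicator {a..b} t =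
      (if t = a then speed M \<Phi> \<gamma> a * indicator {a..b} a else
          if t = b then speed M \<Phi> \<gamma> b * indicator {a..b} b else ennreal (indicator {a<..<b} t *\<^sub>R ?f t))"
      by cases (auto simp: speed_def indicator_def)
  qed
  also have "\<dots> \<in> borel_measurable borel"
    using f by (intro measurable_If) auto
  finally show ?thesis .
qed

lemma pw_C1_speed_measurable:
  assumes M: "smooth_manifold M" and \<Phi>: "finsler_metric M \<Phi>" and \<gamma>: "pw_C1 M \<gamma> a b"
  shows "(\<lambda>t. speed M \<Phi> \<gamma> t * indicator {a..b} t) \<in> borel_measurable borel"
  using \<gamma>
proof induction
  case (piece a b)
  then show ?case by (intro C1_speed_measurable M \<Phi>)
next
  case (snoc a b c)
  have "(\<lambda>t. speed M \<Phi> \<gamma> t * indicator {a..c} t) =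
    (\<lambda>t. if t \<le> b then speed M \<Phi> \<gamma> t * indicator {a..b} t else speed M \<Phi> \<gamma> t * indicator {b..c} t)"
    using pw_C1_less[OF snoc.hyps(1)] snoc.hyps(2) by (auto simp: indicator_def fun_eq_iff)
  also have "\<dots> \<in> borel_measurable borel"
    using snoc.IH C1_speed_measurable[OF M \<Phi> snoc.hyps(3)] by (intro measurable_If) auto
  finally show ?case .
qed

lemma seg_length_add:
  assumes M: "smooth_manifold M" and \<Phi>: "finsler_metric M \<Phi>"
    and "pw_C1 M \<gamma> a b" "pw_C1 M \<gamma> b c"
  shows "seg_length M \<Phi> \<gamma> a c = seg_length M \<Phi> \<gamma> a b + seg_length M \<Phi> \<gamma> b c"
proof -
  have "seg_length M \<Phi> \<gamma> a b + seg_length M \<Phi> \<gamma> b c =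
    (\<integral>\<^sup>+t. speed M \<Phi> \<gamma> t * indicator {a..b} t + speed M \<Phi> \<gamma> t * indicator {b..c} t \<partial>lborel)"
    unfolding seg_length_def
    using pw_C1_speed_measurable[OF M \<Phi> assms(3)] pw_C1_speed_measurable[OF M \<Phi> assms(4)]
    by (intro nn_integral_add[symmetric]) simp_all
  also have "\<dots> = seg_length M \<Phi> \<gamma> a c"
    unfolding seg_length_def
  proof (rule nn_integral_cong_AE)
    \<comment> \<open>The two closed intervals share \<open>b\<close>, where the sum counts the
      speed twice; a single point is a null set.\<close>
    show "AE t in lborel. speed M \<Phi> \<gamma> t * indicator {a..b} t + speed M \<Phi> \<gamma> t * indicator {b..c} t
        = speed M \<Phi> \<gamma> t * indicator {a..c} t"
      using AE_lborel_singleton[of b]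
      by eventually_elim (use pw_C1_less[OF assms(3)] pw_C1_less[OF assms(4)] in \<open>auto simp: indicator_def\<close>)
  qed
  finally show ?thesis by simp
qed

lemma C1_curve_on_cong:
  assumes "C1_curve_on M a b \<gamma>" "\<And>t. t \<in> {a..b} \<Longrightarrow> \<gamma> t = \<eta> t"
  shows "C1_curve_on M a b \<eta>"
  unfolding C1_curve_on_def
proof (intro conjI ballI)
  show "continuous_map (top_of_set {a..b}) (mtop M) \<eta>"
    using assms by (auto simp: C1_curve_on_def intro: continuous_map_eq)
  fix c assume "c \<in> atlas M"
  then obtain \<gamma>' where \<gamma>': "continuous_on {t\<in>{a..b}. \<gamma> t \<in> fst c} \<gamma>'"
      "\<forall>t\<in>{a..b}. \<gamma> t \<in> fst c \<longrightarrow> ((snd c \<circ> \<gamma>) has_vector_derivative \<gamma>' t) (at t within {a..b})"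
    using assms(1) unfolding C1_curve_on_def by blast
  have "{t\<in>{a..b}. \<gamma> t \<in> fst c} = {t\<in>{a..b}. \<eta> t \<in> fst c}" using assms(2) by auto
  moreover have "((snd c \<circ> \<eta>) has_vector_derivative \<gamma>' t) (at t within {a..b})"
    if "t \<in> {a..b}" "\<eta> t \<in> fst c" for t
    using assms(2) that \<gamma>'(2)
    by (intro has_vector_derivative_transform[of t "{a..b}" "snd c \<circ> \<eta>" "snd c \<circ> \<gamma>"]) auto
  ultimately show "\<exists>\<gamma>'. continuous_on {t\<in>{a..b}. \<eta> t \<in> fst c} \<gamma>' \<and>
      (\<forall>t\<in>{a..b}. \<eta> t \<in> fst c \<longrightarrow> ((snd c \<circ> \<eta>) has_vector_derivative \<gamma>' t) (at t within {a..b}))"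
    using \<gamma>'(1) by (intro exI[of _ \<gamma>']) auto
qed

lemma pw_C1_cong:
  assumes "pw_C1 M \<gamma> a b" "\<And>t. t \<in> {a..b} \<Longrightarrow> \<gamma> t = \<eta> t"
  shows "pw_C1 M \<eta> a b"
  using assms
proof induction
  case (piece a b)
  then show ?case by (intro pw_C1.piece C1_curve_on_cong[of M a b \<gamma> \<eta>]) auto
next
  case (snoc a b c)
  have "a < b" using pw_C1_less snoc.hyps by metis
  show ?case
    by (rule pw_C1.snoc[of _ _ _ b])
      (use snoc \<open>a < b\<close> C1_curve_on_cong[of M b c \<gamma> \<eta>] in auto)
qed

text \<open>Agreement on \<open>{a..b}\<close> determines the two-sided derivatives at interior
  times only; the endpoints are negligible in the integral.\<close>

lemma seg_length_cong:
  assumes "\<And>t. t \<in> {a..b} \<Longrightarrow> \<gamma> t = \<eta> t"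
  shows "seg_length M \<Phi> \<gamma> a b = seg_length M \<Phi> \<eta> a b"
  unfolding seg_length_def
proof (rule nn_integral_cong_AE)
  have sp: "speed M \<Phi> \<gamma> t = speed M \<Phi> \<eta> t" if t: "t \<in> {a<..<b}" for t
  proof -
    have "eventually (\<lambda>s. s \<in> {a<..<b}) (nhds t)" using t by (intro eventually_nhds_in_open) auto
    then have "eventually (\<lambda>s. s \<in> UNIV \<longrightarrow> (snd c \<circ> \<gamma>) s = (snd c \<circ> \<eta>) s) (nhds t)" for c :: "('a, 'b) chart"
      by eventually_elim (use assms in auto)
    then have "vector_derivative (snd c \<circ> \<gamma>) (at t) = vector_derivative (snd c \<circ> \<eta>) (at t)" for c :: "('a, 'b) chart"
      by (intro vector_derivative_cong_eq) auto
    then have "velocity M \<gamma> t = velocity M \<eta> t" using assms[of t] t by (auto simp: velocity_def fun_eq_iff)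
    then show ?thesis using assms[of t] t by (simp add: speed_def)
  qed
  show "AE t in lborel. speed M \<Phi> \<gamma> t * indicator {a..b} t = speed M \<Phi> \<eta> t * indicator {a..b} t"
    using AE_not_two[of a b] by eventually_elim (use sp in \<open>auto simp: indicator_def\<close>)
qed

section \<open>Affine reparametrization of curves\<close>

text \<open>The condition on the image, in place of equations for the endpoints, serves increasing
  and decreasing parameter changes alike.\<close>

lemma C1_curve_on_affine:
  assumes \<gamma>: "C1_curve_on M p q \<gamma>" and im: "(\<lambda>t. k + m * t) ` {a..b} = {p..q}"
  shows "C1_curve_on M a b (\<lambda>t. \<gamma> (k + m * t))"
  unfolding C1_curve_on_def
proof (intro conjI ballI)
  let ?A = "\<lambda>t. k + m * t"
  have A: "?A t \<in> {p..q}" if "t \<in> {a..b}" for t using im that by blast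
  have "continuous_map (top_of_set {a..b}) (top_of_set {p..q}) ?A"
    using A by (auto intro!: continuous_intros simp del: atLeastAtMost_iff)
  from continuous_map_compose[OF this, of "mtop M" \<gamma>] \<gamma>
  show "continuous_map (top_of_set {a..b}) (mtop M) (\<lambda>t. \<gamma> (?A t))"
    by (simp add: C1_curve_on_def o_def)
  fix c assume "c \<in> atlas M"
  then obtain \<gamma>' where \<gamma>': "continuous_on {t\<in>{p..q}. \<gamma> t \<in> fst c} \<gamma>'"
      "\<forall>t\<in>{p..q}. \<gamma> t \<in> fst c \<longrightarrow> ((snd c \<circ> \<gamma>) has_vector_derivative \<gamma>' t) (at t within {p..q})"
    using \<gamma> unfolding C1_curve_on_def by blast
  have "continuous_on {t\<in>{a..b}. \<gamma> (?A t) \<in> fst c} (\<lambda>t. m *\<^sub>R \<gamma>' (?A t))"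
    using A by (intro continuous_on_scaleR continuous_on_const continuous_on_compose2[OF \<gamma>'(1)])
      (auto intro!: continuous_intros)
  moreover have "((snd c \<circ> (\<lambda>t. \<gamma> (?A t))) has_vector_derivative m *\<^sub>R \<gamma>' (?A t)) (at t within {a..b})"
    if t: "t \<in> {a..b}" "\<gamma> (?A t) \<in> fst c" for t
  proof -
    have "(?A has_vector_derivative m) (at t within {a..b})"
      by (auto intro!: derivative_eq_intros simp: has_real_derivative_iff_has_vector_derivative[symmetric])
    from vector_diff_chain_within[OF this, of "snd c \<circ> \<gamma>" "\<gamma>' (?A t)"] show ?thesis
      using \<gamma>'(2) t A[OF t(1)] unfolding im by (simp add: o_def)
  qed
  ultimately show "\<exists>\<gamma>'. continuous_on {t\<in>{a..b}. \<gamma> (?A t) \<in> fst c} \<gamma>' \<and>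
      (\<forall>t\<in>{a..b}. \<gamma> (?A t) \<in> fst c \<longrightarrow> ((snd c \<circ> (\<lambda>t. \<gamma> (?A t))) has_vector_derivative \<gamma>' t) (at t within {a..b}))"
    by blast
qed

text \<open>The factor \<open>\<bar>m\<bar>\<close> from the substitution in the integral is the one
  by which the speed is scaled; for negative \<open>m\<close> this uses reversibility.\<close>

lemma seg_length_affine_C1:
  assumes M: "smooth_manifold M" and \<Phi>: "finsler_metric M \<Phi>" "reversible M \<Phi>"
    and \<gamma>: "C1_curve_on M p q \<gamma>" and m: "m \<noteq> 0" and im: "(\<lambda>t. k + m * t) ` {a..b} = {p..q}"
  shows "seg_length M \<Phi> (\<lambda>t. \<gamma> (k + m * t)) a b = seg_length M \<Phi> \<gamma> p q"
proof -
  let ?A = "\<lambda>t. k + m * t" and ?\<eta> = "\<lambda>t. \<gamma> (k + m * t)"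
  have Aiff: "?A t \<in> {p..q} \<longleftrightarrow> t \<in> {a..b}" for t
    unfolding im[symmetric] using m by auto
  have sp: "speed M \<Phi> ?\<eta> t = ennreal \<bar>m\<bar> * speed M \<Phi> \<gamma> (?A t)"
    if A: "?A t \<in> {p<..<q}" for t
  proof -
    have "velocity M ?\<eta> t = (\<lambda>c. m *\<^sub>R velocity M \<gamma> (?A t) c)"
    proof
      fix c
      show "velocity M ?\<eta> t c = m *\<^sub>R velocity M \<gamma> (?A t) c"
      proof (cases "c \<in> charts_at M (\<gamma> (?A t))")
        case True
        have "(?A has_vector_derivative m) (at t)"
          by (auto intro!: derivative_eq_intros simp: has_real_derivative_iff_has_vector_derivative[symmetric])
        from vector_diff_chain_at[OF this C1_curve_on_velocity[OF \<gamma> A True]]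
        have "((snd c \<circ> ?\<eta>) has_vector_derivative m *\<^sub>R velocity M \<gamma> (?A t) c) (at t)"
          by (simp add: o_def)
        then show ?thesis using True vector_derivative_at by (auto simp: velocity_def)
      qed (simp add: velocity_def)
    qed
    moreover have "\<gamma> (?A t) \<in> topspace (mtop M)"
      using A by (intro C1_curve_on_topspace[OF \<gamma>]) auto
    ultimately show ?thesis
      using finsler_metric_scaleR[OF M \<Phi> _ velocity_in_tangent_space[OF M \<gamma> A], of m]
      by (simp add: speed_def ennreal_mult')
  qed
  have "seg_length M \<Phi> \<gamma> p q = ennreal \<bar>m\<bar> * (\<integral>\<^sup>+t. speed M \<Phi> \<gamma> (?A t) * indicator {p..q} (?A t) \<partial>lborel)"
    unfolding seg_length_def
    by (rule nn_integral_real_affine[OF C1_speed_measurable[OF M \<Phi>(1) \<gamma>] m])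
  also have "\<dots> = (\<integral>\<^sup>+t. ennreal \<bar>m\<bar> * (speed M \<Phi> \<gamma> (?A t) * indicator {p..q} (?A t)) \<partial>lborel)"
  proof (rule nn_integral_cmult[symmetric])
    have "?A \<in> borel \<rightarrow>\<^sub>M borel" by measurable
    from measurable_compose[OF this C1_speed_measurable[OF M \<Phi>(1) \<gamma>]]
    show "(\<lambda>t. speed M \<Phi> \<gamma> (?A t) * indicator {p..q} (?A t)) \<in> borel_measurable lborel"
      by simp
  qed
  also have "\<dots> = seg_length M \<Phi> ?\<eta> a b"
    unfolding seg_length_def
  proof (rule nn_integral_cong_AE)
    \<comment> \<open>The speeds are related at parameters sent into the open interval; the
      preimages of \<open>p\<close> and \<open>q\<close> form a null set.\<close>
    show "AE t in lborel. ennreal \<bar>m\<bar> * (speed M \<Phi> \<gamma> (?A t) * indicator {p..q} (?A t))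
        = speed M \<Phi> ?\<eta> t * indicator {a..b} t"
      using AE_not_two[of "(p - k) / m" "(q - k) / m"]
    proof eventually_elim
      case (elim t)
      then have "?A t \<noteq> p" "?A t \<noteq> q" using m by (auto simp: field_simps)
      then show ?case using Aiff[of t] sp[of t] by (auto simp: indicator_def mult.assoc)
    qed
  qed
  finally show ?thesis by simp
qed

lemma image_affine_interval:
  fixes m :: real
  assumes m: "m \<noteq> 0" and "p \<le> q"
  shows "(\<lambda>t. k + m * t) ` {min ((p - k) / m) ((q - k) / m) .. max ((p - k) / m) ((q - k) / m)} = {p..q}"
    (is "?A ` {?a..?b} = _")
proof -
  have "t \<in> {?a..?b} \<longleftrightarrow> ?A t \<in> {p..q}" for t
  proof (cases "m > 0")
    case True
    then have "(p - k) / m \<le> (q - k) / m" using assms(2) by (simp add: divide_right_mono)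
    then have "?a = (p - k) / m" "?b = (q - k) / m" by auto
    then show ?thesis using True by (auto simp: pos_divide_le_eq pos_le_divide_eq algebra_simps)
  next
    case False
    then have m: "m < 0" using m by simp
    then have "(q - k) / m \<le> (p - k) / m" using assms(2) by (simp add: divide_right_mono_neg)
    then have "?a = (q - k) / m" "?b = (p - k) / m" by auto
    then show ?thesis using m by (auto simp: neg_divide_le_eq neg_le_divide_eq algebra_simps)
  qed
  note mem = this
  show ?thesis
  proof (intro subset_antisym subsetI)
    fix t assume t: "t \<in> {p..q}"
    have A: "?A ((t - k) / m) = t" using m by simp
    show "t \<in> ?A ` {?a..?b}"
      by (rule image_eqI[of _ _ "(t - k) / m"]) (simp_all only: mem A t)
  qed (use mem in blast)
qed

section \<open>The Finsler distance\<close>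

text \<open>\<open>A\<close> inverts the parameter change, and \<open>min\<close> and
  \<open>max\<close> order the new endpoints whatever the sign of \<open>m\<close>. A piece appended
  to \<gamma> becomes the last piece of \<eta> for positive \<open>m\<close> and the first one for
  negative \<open>m\<close>, hence the two cases.\<close>

lemma pw_C1_affine:
  fixes k m :: real
  assumes M: "smooth_manifold M" and \<Phi>: "finsler_metric M \<Phi>" "reversible M \<Phi>" and m: "m \<noteq> 0"
    and "pw_C1 M \<gamma> p q"
  defines "\<eta> \<equiv> \<lambda>t. \<gamma> (k + m * t)" and "A \<equiv> \<lambda>s. (s - k) / m"
  shows "pw_C1 M \<eta> (min (A p) (A q)) (max (A p) (A q)) \<and>
    seg_length M \<Phi> \<eta> (min (A p) (A q)) (max (A p) (A q)) = seg_length M \<Phi> \<gamma> p q"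
proof -
  have C1: "C1_curve_on M (min (A p) (A q)) (max (A p) (A q)) \<eta>"
    "min (A p) (A q) < max (A p) (A q)"
    "seg_length M \<Phi> \<eta> (min (A p) (A q)) (max (A p) (A q)) = seg_length M \<Phi> \<gamma> p q"
    if "p < q" "C1_curve_on M p q \<gamma>" for p q
  proof -
    have im: "(\<lambda>t. k + m * t) ` {min (A p) (A q) .. max (A p) (A q)} = {p..q}"
      unfolding A_def by (rule image_affine_interval[OF m less_imp_le[OF that(1)]])
    show "C1_curve_on M (min (A p) (A q)) (max (A p) (A q)) \<eta>"
      unfolding \<eta>_def by (rule C1_curve_on_affine[OF that(2) im])
    show "seg_length M \<Phi> \<eta> (min (A p) (A q)) (max (A p) (A q)) = seg_length M \<Phi> \<gamma> p q"
      unfolding \<eta>_def by (rule seg_length_affine_C1[OF M \<Phi> that(2) m im])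
    have "A p \<noteq> A q" using that m by (simp add: A_def)
    then show "min (A p) (A q) < max (A p) (A q)" by (auto simp: min_def max_def)
  qed
  show ?thesis
    using assms(5)
  proof induction
    case (piece a b)
    then show ?case using C1[OF piece] by (auto intro: pw_C1.piece)
  next
    case (snoc a b c)
    note bc = C1[OF snoc.hyps(2,3)]
    have pbc: "pw_C1 M \<eta> (min (A b) (A c)) (max (A b) (A c))"
      using bc by (intro pw_C1.piece)
    have ab: "a < b" using snoc.hyps(1) by (rule pw_C1_less)
    have add: "seg_length M \<Phi> \<gamma> a c = seg_length M \<Phi> \<gamma> a b + seg_length M \<Phi> \<gamma> b c"
      by (rule seg_length_add[OF M \<Phi>(1) snoc.hyps(1) pw_C1.piece[OF snoc.hyps(2,3)]])
    show ?case
    proof (cases "m > 0")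
      case True
      then have o: "A a < A b" "A b < A c" "A a < A c" using ab snoc.hyps(2)
        by (auto simp: A_def divide_simps)
      have mm: "min (A a) (A b) = A a" "max (A a) (A b) = A b" "min (A b) (A c) = A b"
        "max (A b) (A c) = A c" "min (A a) (A c) = A a" "max (A a) (A c) = A c"
        using o by auto
      show ?thesis using snoc.IH bc(3) pbc pw_C1_trans seg_length_add[OF M \<Phi>(1), of \<eta> "A a" "A b" "A c"]
        unfolding mm add by auto
    next
      case False
      then have o: "A b < A a" "A c < A b" "A c < A a" using ab snoc.hyps(2) m
        by (auto simp: A_def divide_simps)
      have mm: "min (A a) (A b) = A b" "max (A a) (A b) = A a" "min (A b) (A c) = A c"
        "max (A b) (A c) = A b" "min (A a) (A c) = A c" "max (A a) (A c) = A a"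
        using o by auto
      show ?thesis using snoc.IH bc(3) pbc pw_C1_trans seg_length_add[OF M \<Phi>(1), of \<eta> "A c" "A b" "A a"]
        unfolding mm add by (auto simp: add.commute)
    qed
  qed
qed

lemma finsler_dist_le:
  "pw_C1 M \<gamma> 0 1 \<Longrightarrow> \<gamma> 0 = x \<Longrightarrow> \<gamma> 1 = y \<Longrightarrow> finsler_dist M \<Phi> x y \<le> seg_length M \<Phi> \<gamma> 0 1"
  unfolding finsler_dist_def finsler_length_eq[symmetric] piecewise_C1_curve_iff
  by (intro INF_lower) auto

lemma finsler_dist_greatest:
  "(\<And>\<gamma>. pw_C1 M \<gamma> 0 1 \<Longrightarrow> \<gamma> 0 = x \<Longrightarrow> \<gamma> 1 = y \<Longrightarrow> u \<le> seg_length M \<Phi> \<gamma> 0 1)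
    \<Longrightarrow> u \<le> finsler_dist M \<Phi> x y"
  unfolding finsler_dist_def finsler_length_eq piecewise_C1_curve_iff
  by (intro INF_greatest) auto

lemma finsler_dist_commute:
  assumes M: "smooth_manifold M" and \<Phi>: "finsler_metric M \<Phi>" "reversible M \<Phi>"
  shows "finsler_dist M \<Phi> x y = finsler_dist M \<Phi> y x"
proof -
  have "finsler_dist M \<Phi> y x \<le> finsler_dist M \<Phi> x y" for x y
  proof (rule finsler_dist_greatest)
    fix \<gamma> assume \<gamma>: "pw_C1 M \<gamma> 0 1" "\<gamma> 0 = x" "\<gamma> 1 = y"
    \<comment> \<open>The reversed curve, with its argument kept in the form
      \<open>k + m * t\<close> of the affine lemma.\<close>
    have "pw_C1 M (\<lambda>t. \<gamma> (1 + (-1) * t)) 0 1"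
      "seg_length M \<Phi> (\<lambda>t. \<gamma> (1 + (-1) * t)) 0 1 = seg_length M \<Phi> \<gamma> 0 1"
      using pw_C1_affine[OF M \<Phi> _ \<gamma>(1), of "-1" 1] by (simp_all add: min_def max_def)
    then show "finsler_dist M \<Phi> y x \<le> seg_length M \<Phi> \<gamma> 0 1"
      using finsler_dist_le[of M "\<lambda>t. \<gamma> (1 + (-1) * t)" y x \<Phi>] \<gamma>(2,3) by simp
  qed
  then show ?thesis by (intro antisym)
qed

text \<open>If the right-hand side is finite, each infimum has a competitor within
  \<open>e / 2\<close>. Finiteness matters here, since \<open>X < X + ennreal e\<close> fails for
  \<open>X = top\<close>.\<close>

lemma le_add_INF_ennreal:
  fixes f :: "'a \<Rightarrow> ennreal" and g :: "'b \<Rightarrow> ennreal"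
  assumes "\<And>x y. x \<in> A \<Longrightarrow> y \<in> B \<Longrightarrow> u \<le> f x + g y"
  shows "u \<le> (INF x\<in>A. f x) + (INF y\<in>B. g y)"
proof (rule ennreal_le_epsilon)
  have less_add: "X < X + ennreal e" if "X < top" "0 < e" for X e
    using that by (cases X) (auto simp: ennreal_plus[symmetric] ennreal_less_iff simp del: ennreal_plus)
  fix e :: real assume fin: "(INF x\<in>A. f x) + (INF y\<in>B. g y) < top" and e: "0 < e"
  have "(INF x\<in>A. f x) < (INF x\<in>A. f x) + ennreal (e / 2)"
    using fin e by (intro less_add) auto
  then obtain x where x: "x \<in> A" "f x < (INF x\<in>A. f x) + ennreal (e / 2)"
    unfolding INF_less_iff by blast
  have "(INF y\<in>B. g y) < (INF y\<in>B. g y) + ennreal (e / 2)"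
    using fin e by (intro less_add) auto
  then obtain y where y: "y \<in> B" "g y < (INF y\<in>B. g y) + ennreal (e / 2)"
    unfolding INF_less_iff by blast
  have "u \<le> f x + g y" using assms x y by simp
  also have "\<dots> \<le> ((INF x\<in>A. f x) + ennreal (e / 2)) + ((INF y\<in>B. g y) + ennreal (e / 2))"
    using x y by (intro add_mono) auto
  also have "\<dots> = (INF x\<in>A. f x) + (INF y\<in>B. g y) + (ennreal (e / 2) + ennreal (e / 2))"
    by (simp add: ac_simps)
  also have "ennreal (e / 2) + ennreal (e / 2) = ennreal e"
    using e by (simp add: ennreal_plus[symmetric] del: ennreal_plus)
  finally show "u \<le> (INF x\<in>A. f x) + (INF y\<in>B. g y) + ennreal e" .
qed

lemma finsler_dist_triangle:
  assumes M: "smooth_manifold M" and \<Phi>: "finsler_metric M \<Phi>" "reversible M \<Phi>"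
  shows "finsler_dist M \<Phi> x z \<le> finsler_dist M \<Phi> x y + finsler_dist M \<Phi> y z"
  unfolding finsler_dist_def[of M \<Phi> x y] finsler_dist_def[of M \<Phi> y z]
proof (rule le_add_INF_ennreal)
  fix \<alpha> \<beta>
  assume "\<alpha> \<in> {\<gamma>. piecewise_C1_curve M \<gamma> \<and> \<gamma> 0 = x \<and> \<gamma> 1 = y}"
    and "\<beta> \<in> {\<gamma>. piecewise_C1_curve M \<gamma> \<and> \<gamma> 0 = y \<and> \<gamma> 1 = z}"
  then have \<alpha>: "pw_C1 M \<alpha> 0 1" "\<alpha> 0 = x" "\<alpha> 1 = y" and \<beta>: "pw_C1 M \<beta> 0 1" "\<beta> 0 = y" "\<beta> 1 = z"
    by (auto simp: piecewise_C1_curve_iff)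
  \<comment> \<open>Concatenation at double speed, again with arguments of the form
    \<open>k + m * t\<close>. At \<open>t = 1/2\<close> the first branch is taken; it agrees with
    the second because both curves are at \<open>y\<close>.\<close>
  define \<gamma> where "\<gamma> t = (if t \<le> 1/2 then \<alpha> (0 + 2 * t) else \<beta> (-1 + 2 * t))" for t :: real
  have g1: "\<And>t. t \<in> {0..1/2} \<Longrightarrow> \<alpha> (0 + 2 * t) = \<gamma> t"
    and g2: "\<And>t. t \<in> {1/2..1} \<Longrightarrow> \<beta> (-1 + 2 * t) = \<gamma> t"
  proof -
    show "\<alpha> (0 + 2 * t) = \<gamma> t" if "t \<in> {0..1/2}" for t using that by (simp add: \<gamma>_def)
    show "\<beta> (-1 + 2 * t) = \<gamma> t" if "t \<in> {1/2..1}" for t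
    proof (cases "t = 1/2")
      case True
      show ?thesis unfolding True \<gamma>_def using \<alpha>(3) \<beta>(2) by simp
    qed (use that in \<open>simp add: \<gamma>_def\<close>)
  qed
  have 1: "pw_C1 M (\<lambda>t. \<alpha> (0 + 2 * t)) 0 (1/2)"
    "seg_length M \<Phi> (\<lambda>t. \<alpha> (0 + 2 * t)) 0 (1/2) = seg_length M \<Phi> \<alpha> 0 1"
    using pw_C1_affine[OF M \<Phi> _ \<alpha>(1), of 2 0] by (simp_all add: min_def max_def)
  have 2: "pw_C1 M (\<lambda>t. \<beta> (-1 + 2 * t)) (1/2) 1"
    "seg_length M \<Phi> (\<lambda>t. \<beta> (-1 + 2 * t)) (1/2) 1 = seg_length M \<Phi> \<beta> 0 1"
    using pw_C1_affine[OF M \<Phi> _ \<beta>(1), of 2 "-1"] by (simp_all add: min_def max_def)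
  have pw: "pw_C1 M \<gamma> 0 (1/2)" "pw_C1 M \<gamma> (1/2) 1"
    by (rule pw_C1_cong[OF 1(1) g1], assumption, rule pw_C1_cong[OF 2(1) g2], assumption)
  have "seg_length M \<Phi> \<gamma> 0 1 = seg_length M \<Phi> \<gamma> 0 (1/2) + seg_length M \<Phi> \<gamma> (1/2) 1"
    by (rule seg_length_add[OF M \<Phi>(1) pw])
  also have "\<dots> = seg_length M \<Phi> \<alpha> 0 1 + seg_length M \<Phi> \<beta> 0 1"
    using 1(2) 2(2) seg_length_cong[where M=M and \<Phi>=\<Phi>, OF g1] seg_length_cong[where M=M and \<Phi>=\<Phi>, OF g2] by simp
  finally have "seg_length M \<Phi> \<gamma> 0 1 = finsler_length M \<Phi> \<alpha> + finsler_length M \<Phi> \<beta>"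
    by (simp add: finsler_length_eq)
  moreover have "finsler_dist M \<Phi> x z \<le> seg_length M \<Phi> \<gamma> 0 1"
    by (rule finsler_dist_le[OF pw_C1_trans[OF pw(2,1)]]) (use \<alpha> \<beta> in \<open>auto simp: \<gamma>_def\<close>)
  ultimately show "finsler_dist M \<Phi> x z \<le> finsler_length M \<Phi> \<alpha> + finsler_length M \<Phi> \<beta>" by simp
qed

section \<open>Standard manifolds\<close>

lemma second_countable_euclidean: "second_countable (euclidean :: 'a::second_countable_topology topology)"
proof -
  obtain B :: "'a set set" where B: "countable B" "topological_basis B"
    using ex_countable_basis by blast
  show ?thesis
    unfolding second_countable_def
  proof (intro exI conjI allI ballI impI)
    show "countable B" by (rule B)
    show "openin euclidean V" if "V \<in> B" for V
      using topological_basis_open[OF B(2) that] by (simp add: open_openin[symmetric])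
    show "\<exists>V\<in>B. x \<in> V \<and> V \<subseteq> U" if "openin euclidean U \<and> x \<in> U" for U x
      using topological_basisE[OF B(2), of U x] that by (metis open_openin)
  qed
qed

lemma mtop_standard [simp]: "mtop (standard_manifold S) = top_of_set S"
  by (simp add: standard_manifold_def)

lemma atlas_standard:
  "c \<in> atlas (standard_manifold S) \<longleftrightarrow> openin (top_of_set S) (fst c) \<and> inj_on (snd c) (fst c) \<and>
     (\<exists>I. openin (top_of_set (sector I)) (snd c ` fst c)) \<and>
     smooth_on (fst c) (snd c) \<and> smooth_on (snd c ` fst c) (chart_inv c)"
  by (simp add: standard_manifold_def)

text \<open>Charts of the standard atlas are diffeomorphisms, so a coordinate change is the smooth
  inverse of one followed by the smooth coordinate map of another. What depends on \<open>S\<close>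
  is the existence of a chart at each point.\<close>

lemma smooth_manifold_standard:
  assumes "\<And>p. p \<in> S \<Longrightarrow> \<exists>c\<in>atlas (standard_manifold S). p \<in> fst c"
  shows "smooth_manifold (standard_manifold S)"
  unfolding smooth_manifold_def
proof (intro conjI ballI)
  show "Hausdorff_space (mtop (standard_manifold S))"
    by (simp add: Hausdorff_space_subtopology)
  show "second_countable (mtop (standard_manifold S))"
    by (simp add: second_countable_subtopology second_countable_euclidean)
  show "(\<Union>c\<in>atlas (standard_manifold S). fst c) = topspace (mtop (standard_manifold S))"
    using assms openin_imp_subset by (fastforce simp: atlas_standard)
next
  fix c assume "c \<in> atlas (standard_manifold S)"
  then have c: "openin (top_of_set S) (fst c)" "inj_on (snd c) (fst c)"
    "\<exists>I. openin (top_of_set (sector I)) (snd c ` fst c)"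
    "smooth_on (fst c) (snd c)" "smooth_on (snd c ` fst c) (chart_inv c)"
    by (simp_all only: atlas_standard)
  show "openin (mtop (standard_manifold S)) (fst c)" using c(1) by simp
  show "\<exists>I. openin (top_of_set (sector I)) (snd c ` fst c)" by (rule c)
  have "fst c \<subseteq> S" using c(1) by (rule openin_imp_subset)
  then have eq: "subtopology (mtop (standard_manifold S)) (fst c) = top_of_set (fst c)"
    by (simp add: subtopology_subtopology inf_absorb2)
  have "homeomorphic_maps (top_of_set (fst c)) (top_of_set (snd c ` fst c)) (snd c) (chart_inv c)"
    unfolding homeomorphic_maps_def
    using smooth_on_imp_continuous_on[OF c(4)] smooth_on_imp_continuous_on[OF c(5)]
      chart_inv_eq[OF c(2)] by auto
  then show "homeomorphic_map (subtopology (mtop (standard_manifold S)) (fst c))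
      (top_of_set (snd c ` fst c)) (snd c)"
    unfolding eq by (auto simp: homeomorphic_map_maps)
next
  fix c d assume c: "c \<in> atlas (standard_manifold S)" and d: "d \<in> atlas (standard_manifold S)"
  show "smooth_on (snd c ` (fst c \<inter> fst d)) (snd d \<circ> chart_inv c)"
  proof (rule smooth_on_compose[where T="fst d"])
    show "smooth_on (snd c ` (fst c \<inter> fst d)) (chart_inv c)"
      by (rule smooth_on_subset[of "snd c ` fst c"]) (use c in \<open>auto simp: atlas_standard\<close>)
    show "smooth_on (fst d) (snd d)" using d by (simp add: atlas_standard)
    have "inj_on (snd c) (fst c)" using c by (simp add: atlas_standard)
    then show "chart_inv c ` snd c ` (fst c \<inter> fst d) \<subseteq> fst d"
      by (auto simp: chart_inv_eq)
  qed
qed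

lemma affine_chart_in_atlas:
  fixes K L :: "real ^ 'n \<Rightarrow> real ^ 'n"
  assumes "linear K" "linear L" "\<And>x. L (K x) = x"
    and "openin (top_of_set S) U" "openin (top_of_set (sector I)) ((\<lambda>x. K x + k) ` U)"
  shows "(U, \<lambda>x. K x + k) \<in> atlas (standard_manifold S)"
proof -
  have inj: "inj_on (\<lambda>x. K x + k) U"
    by (rule inj_on_inverseI[where g="\<lambda>y. L (y - k)"]) (simp add: assms(3))
  have "smooth_on ((\<lambda>x. K x + k) ` U) (chart_inv (U, \<lambda>x. K x + k))"
  proof (rule smooth_on_cong)
    show "smooth_on ((\<lambda>x. K x + k) ` U) (\<lambda>y. L y + L (- k))"
      using assms(2) by (intro smooth_on_affine) (simp add: linear_conv_bounded_linear)
    show "L y + L (- k) = chart_inv (U, \<lambda>x. K x + k) y" if "y \<in> (\<lambda>x. K x + k) ` U" for y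
      using that chart_inv_eq[of "(U, \<lambda>x. K x + k)"] inj assms(3)
      by (auto simp: linear_add[OF assms(2), symmetric])
  qed
  then show ?thesis
    using assms inj by (auto simp: atlas_standard linear_conv_bounded_linear intro: smooth_on_affine)
qed

text \<open>The condition has to be verified in every chart of the standard atlas, including
  nonlinear ones. Locally the coordinate map extends to a smooth \<open>g\<close>, whose derivative
  along \<open>q - p\<close> is a continuous velocity.\<close>

lemma C1_curve_on_segment:
  fixes p q :: "real ^ 'n"
  assumes "\<And>t. t \<in> {0..1} \<Longrightarrow> p + t *\<^sub>R (q - p) \<in> S"
  shows "C1_curve_on (standard_manifold S) 0 1 (\<lambda>t. p + t *\<^sub>R (q - p))"
  unfolding C1_curve_on_def
proof (intro conjI ballI)
  let ?\<sigma> = "\<lambda>t. p + t *\<^sub>R (q - p)"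
  have cont: "continuous_on A ?\<sigma>" for A by (intro continuous_intros)
  show "continuous_map (top_of_set {0..1}) (mtop (standard_manifold S)) ?\<sigma>"
    using assms cont by auto
  fix c assume "c \<in> atlas (standard_manifold S)"
  then have c: "openin (top_of_set S) (fst c)" "smooth_on (fst c) (snd c)"
    by (simp_all only: atlas_standard)
  let ?T = "{t\<in>{0..1}. ?\<sigma> t \<in> fst c}"
  \<comment> \<open>The extensions \<open>g\<close> exist only locally, so the candidate velocity is
    defined without them; uniqueness of the derivative on \<open>{0..1}\<close> identifies it with
    the formula from each \<open>g\<close>.\<close>
  define v where "v t = vector_derivative (snd c \<circ> ?\<sigma>) (at t within {0..1})" for t
  have deriv: "((snd c \<circ> ?\<sigma>) has_vector_derivative frechet_derivative g (at (?\<sigma> t)) (q - p)) (at t within {0..1})"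
      "v t = frechet_derivative g (at (?\<sigma> t)) (q - p)"
    if W: "open W" "\<forall>k. C_k_on k W g" "\<forall>y\<in>fst c \<inter> W. g y = snd c y" and t: "t \<in> ?T" "?\<sigma> t \<in> W" for t W g
  proof -
    let ?D = "frechet_derivative g (at (?\<sigma> t)) (q - p)"
    obtain V where V: "open V" "fst c = S \<inter> V" using c(1) by (auto simp: openin_open)
    \<comment> \<open>At times of \<open>{0..1}\<close> in this open set the segment lies in the
      chart domain and in \<open>W\<close>, where the coordinate map is \<open>g\<close>.\<close>
    define O' where "O' = ?\<sigma> -` (V \<inter> W)"
    have "open O'" unfolding O'_def
      using V(1) W(1) cont[of UNIV] by (intro open_vimage open_Int)
    have tO: "t \<in> O'" using t V by (auto simp: O'_def)
    have w: "at t within ({0..1} \<inter> O') = at t within {0..1}"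
      by (rule at_within_nhd[OF tO \<open>open O'\<close>]) auto
    have \<sigma>: "(?\<sigma> has_derivative (\<lambda>h. h *\<^sub>R (q - p))) (at t within ({0..1} \<inter> O'))"
      by (auto intro!: derivative_eq_intros)
    have g: "(g has_derivative frechet_derivative g (at (?\<sigma> t))) (at (?\<sigma> t))"
      by (rule C_k_on_has_derivative[OF spec[OF W(2)] t(2)])
    have "((\<lambda>t. g (?\<sigma> t)) has_derivative (\<lambda>h. frechet_derivative g (at (?\<sigma> t)) (h *\<^sub>R (q - p))))
      (at t within ({0..1} \<inter> O'))"
      by (rule has_derivative_compose[OF \<sigma> g])
    then have "((\<lambda>t. g (?\<sigma> t)) has_vector_derivative ?D) (at t within ({0..1} \<inter> O'))"
      unfolding has_vector_derivative_def linear_scale[OF has_derivative_linear[OF g]] .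
    then have "((snd c \<circ> ?\<sigma>) has_vector_derivative ?D) (at t within ({0..1} \<inter> O'))"
    proof (rule has_vector_derivative_transform[rotated 2])
      show "t \<in> {0..1} \<inter> O'" using t tO by auto
      show "(snd c \<circ> ?\<sigma>) s = g (?\<sigma> s)" if "s \<in> {0..1} \<inter> O'" for s
        using that W(3) V(2) assms by (auto simp: O'_def)
    qed
    then show d: "((snd c \<circ> ?\<sigma>) has_vector_derivative ?D) (at t within {0..1})"
      unfolding w .
    show "v t = ?D" unfolding v_def
      using vector_derivative_within_cbox[of 0 1 t "snd c \<circ> ?\<sigma>" ?D] d t by simp
  qed
  have "continuous_on ?T v"
    unfolding continuous_on_eq_continuous_within
  proof
    fix t assume t: "t \<in> ?T"
    then obtain W g where W: "open W" "?\<sigma> t \<in> W" "\<forall>k. C_k_on k W g" "\<forall>y\<in>fst c \<inter> W. g y = snd c y"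
      using smooth_onE[OF c(2)] by blast
    let ?N = "?T \<inter> ?\<sigma> -` W"
    have "open (?\<sigma> -` W)" using W(1) cont[of UNIV] by (intro open_vimage)
    have "continuous_on W (\<lambda>x. frechet_derivative g (at x) (q - p))"
      using spec[OF W(3), of "Suc 0"] by simp
    then have "isCont (\<lambda>x. frechet_derivative g (at x) (q - p)) (?\<sigma> t)"
      using W continuous_on_eq_continuous_at by blast
    moreover have "continuous (at t within ?T) ?\<sigma>"
      using cont[of UNIV] by (intro continuous_intros)
    ultimately have "continuous (at t within ?T) (\<lambda>s. frechet_derivative g (at (?\<sigma> s)) (q - p))"
      using continuous_within_compose3[of ?\<sigma> t "\<lambda>x. frechet_derivative g (at x) (q - p)" ?T] by simp
    then show "continuous (at t within ?T) v"
    proof (rule continuous_transform_within_openin[of _ _ _ ?N])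
      show "openin (top_of_set ?T) ?N" using \<open>open (?\<sigma> -` W)\<close> by (rule openin_open_Int)
      show "t \<in> ?N" using t W by auto
      show "frechet_derivative g (at (?\<sigma> s)) (q - p) = v s" if "s \<in> ?N" for s
        using deriv(2)[OF W(1,3,4)] that by simp
    qed
  qed
  moreover have "((snd c \<circ> ?\<sigma>) has_vector_derivative v t) (at t within {0..1})"
    if t: "t \<in> {0..1}" "?\<sigma> t \<in> fst c" for t
  proof -
    obtain W g where W: "open W" "?\<sigma> t \<in> W" "\<forall>k. C_k_on k W g" "\<forall>y\<in>fst c \<inter> W. g y = snd c y"
      using smooth_onE[OF c(2) t(2)] by blast
    show ?thesis using deriv[OF W(1,3,4) _ W(2)] t by simp
  qed
  ultimately show "\<exists>\<gamma>'. continuous_on ?T \<gamma>' \<and>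
      (\<forall>t\<in>{0..1}. ?\<sigma> t \<in> fst c \<longrightarrow> ((snd c \<circ> ?\<sigma>) has_vector_derivative \<gamma>' t) (at t within {0..1}))"
    by blast
qed

lemma affine_chart_speed:
  fixes K :: "real ^ 'n \<Rightarrow> real ^ 'n" and k :: "real ^ 'n" and p q :: "real ^ 'n"
  assumes M: "smooth_manifold (standard_manifold S)" and K: "linear K"
    and c: "c = (U, \<lambda>x. K x + k)" "c \<in> atlas (standard_manifold S)"
    and seg: "\<And>t. t \<in> {0..1} \<Longrightarrow> p + t *\<^sub>R (q - p) \<in> U" and t: "t \<in> {0<..<1}"
  defines "\<sigma> \<equiv> \<lambda>t. p + t *\<^sub>R (q - p)"
  shows "velocity (standard_manifold S) \<sigma> t = tangent_vec (standard_manifold S) c (\<sigma> t) (K (q - p))"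
proof -
  have US: "U \<subseteq> S" using c openin_imp_subset by (fastforce simp: atlas_standard)
  have C1: "C1_curve_on (standard_manifold S) 0 1 \<sigma>"
    unfolding \<sigma>_def using seg US by (intro C1_curve_on_segment) auto
  have ct: "c \<in> charts_at (standard_manifold S) (\<sigma> t)"
    using c seg[of t] t by (simp add: charts_at_def \<sigma>_def)
  have "((\<lambda>t. K (\<sigma> t) + k) has_vector_derivative K (q - p)) (at t)"
  proof -
    have "(\<lambda>t. K (\<sigma> t) + k) = (\<lambda>t. (K p + k) + t *\<^sub>R K (q - p))"
      unfolding \<sigma>_def linear_add[OF K] linear_scale[OF K] by (simp only: ac_simps)
    then show ?thesis by (auto intro!: derivative_eq_intros simp: has_vector_derivative_def)
  qed
  then have "((snd c \<circ> \<sigma>) has_vector_derivative K (q - p)) (at t)"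
    by (simp add: c(1) o_def)
  then have "velocity (standard_manifold S) \<sigma> t c = K (q - p)"
    using ct vector_derivative_at by (auto simp: velocity_def)
  with velocity_eq_tangent_vec[OF M C1 t ct] show ?thesis by simp
qed

text \<open>\<open>H\<close> is the metric in chart coordinates; it is continuous and vanishes at
  \<open>(K p + k, 0)\<close>. The segment to a nearby \<open>q\<close>, run in unit time, has its
  positions and its constant coordinate velocity close to this pair, so its speed stays below
  \<open>e\<close>.\<close>

lemma finsler_dist_segment_small:
  fixes K :: "real ^ 'n::finite \<Rightarrow> real ^ 'n"
  assumes M: "smooth_manifold (standard_manifold S)" and \<Phi>: "finsler_metric (standard_manifold S) \<Phi>"
    and K: "linear K" and c: "(U, \<lambda>x. K x + k) \<in> atlas (standard_manifold S)"
    and p: "p \<in> U" and U: "convex U" and e: "0 < e"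
  shows "\<exists>\<delta>>0. \<forall>q\<in>S. dist p q < \<delta> \<longrightarrow> finsler_dist (standard_manifold S) \<Phi> p q \<le> ennreal e"
proof -
  let ?M = "standard_manifold S" and ?c = "(U, \<lambda>x. K x + k)"
  define H where "H = (\<lambda>(x, w). \<Phi> (chart_inv ?c x) (tangent_vec ?M ?c (chart_inv ?c x) w))"
  have US: "openin (top_of_set S) U" and inj: "inj_on (\<lambda>x. K x + k) U"
    using c by (simp_all add: atlas_standard)
  have inv: "chart_inv ?c (K x + k) = x" if "x \<in> U" for x
    using chart_inv_eq[of ?c] that inj by simp
  have cont: "continuous_on ((snd ?c ` fst ?c) \<times> UNIV) H"
    unfolding H_def using \<Phi> c unfolding finsler_metric_def by blast
  have "(K p + k, 0) \<in> (snd ?c ` fst ?c) \<times> UNIV" using p by auto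
  from bspec[OF cont[unfolded continuous_on_iff] this] e
  obtain d where d: "0 < d" "\<forall>z\<in>(snd ?c ` fst ?c) \<times> UNIV.
      dist z (K p + k, 0) < d \<longrightarrow> dist (H z) (H (K p + k, 0)) < e"
    by blast
  have pS: "p \<in> S" using US p openin_imp_subset by blast
  have cp: "?c \<in> charts_at ?M p" using c p by (simp add: charts_at_def)
  have H0: "H (K p + k, 0) = 0"
  proof -
    have "(\<lambda>d. 0) \<in> tangent_space ?M p"
      using tangent_vec_0[OF M] by (auto simp: tangent_space_def)
    then have "\<Phi> p (\<lambda>d. 0) = 0"
      using \<Phi> pS unfolding finsler_metric_def asymmetric_norm_on_def by (metis mtop_standard topspace_euclidean_subtopology)
    then show ?thesis by (simp add: H_def inv p tangent_vec_0[OF M cp])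
  qed
  obtain B where B: "0 < B" "\<And>x. norm (K x) \<le> B * norm x"
    using linear_bounded_pos[OF K] by blast
  obtain r where r: "0 < r" "ball p r \<inter> S \<subseteq> U"
    using US p unfolding openin_contains_ball by blast
  \<comment> \<open>The radius \<open>r\<close> puts \<open>q\<close> into \<open>U\<close>, and
    convexity the whole segment. Displacement and velocity are each bounded by
    \<open>norm (K (q - p))\<close>, hence by \<open>B * norm (q - p)\<close>; the factor 2 keeps
    their sum below \<open>d\<close>.\<close>
  show ?thesis
  proof (intro exI[of _ "min r (d / (2 * B))"] conjI ballI impI)
    show "0 < min r (d / (2 * B))" using r d B by simp
    fix q assume q: "q \<in> S" "dist p q < min r (d / (2 * B))"
    let ?\<sigma> = "\<lambda>t. p + t *\<^sub>R (q - p)"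
    have "q \<in> U" using q r by auto
    have seg: "?\<sigma> t \<in> U" if "t \<in> {0..1}" for t
    proof -
      have "(1 - t) *\<^sub>R p + t *\<^sub>R q \<in> U"
        using convexD_alt[OF U p \<open>q \<in> U\<close>, of t] that by simp
      then show ?thesis by (simp add: algebra_simps)
    qed
    have "C1_curve_on ?M 0 1 ?\<sigma>"
      using seg openin_imp_subset[OF US] by (intro C1_curve_on_segment) auto
    then have pw: "pw_C1 ?M ?\<sigma> 0 1" by (intro pw_C1.piece) auto
    have n: "norm (K (q - p)) * 2 < d"
    proof -
      have "norm (K (q - p)) \<le> B * norm (q - p)" by (rule B)
      also have "\<dots> < B * (d / (2 * B))"
        using q(2) B(1) by (intro mult_strict_left_mono) (auto simp: dist_norm norm_minus_commute)
      finally show ?thesis using B(1) by simp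
    qed
    have sp: "speed ?M \<Phi> ?\<sigma> t \<le> ennreal e" if t: "t \<in> {0<..<1}" for t
    proof -
      let ?z = "(K (?\<sigma> t) + k, K (q - p))"
      have "K (?\<sigma> t) + k - (K p + k) = t *\<^sub>R K (q - p)"
        by (simp add: linear_add[OF K] linear_scale[OF K])
      then have "norm (?z - (K p + k, 0)) \<le> norm (t *\<^sub>R K (q - p)) + norm (K (q - p))"
        using norm_Pair_le[of "K (?\<sigma> t) + k - (K p + k)" "K (q - p)"] by (simp only: diff_Pair diff_0_right)
      also have "\<dots> \<le> 2 * norm (K (q - p))" using t by (simp add: mult_left_le_one_le)
      finally have "dist ?z (K p + k, 0) < d" using n by (simp add: dist_norm)
      then have "dist (H ?z) 0 < e" using bspec[OF d(2), of ?z] seg[of t] t unfolding H0 by auto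
      moreover have "\<Phi> (?\<sigma> t) (velocity ?M ?\<sigma> t) = H ?z"
        using affine_chart_speed[OF M K refl c seg t] seg[of t] t by (simp add: H_def inv)
      ultimately show ?thesis by (auto simp: speed_def dist_real_def intro!: ennreal_leI)
    qed
    have "finsler_dist ?M \<Phi> p q \<le> seg_length ?M \<Phi> ?\<sigma> 0 1"
      by (rule finsler_dist_le[OF pw]) auto
    also have "\<dots> \<le> (\<integral>\<^sup>+t\<in>{0..1::real}. ennreal e \<partial>lborel)"
      unfolding seg_length_def
    proof (rule nn_integral_mono_AE)
      show "AE t in lborel. speed ?M \<Phi> ?\<sigma> t * indicator {0..1} t \<le> ennreal e * indicator {0..1} t"
        using AE_not_two[of 0 1] by eventually_elim (use sp in \<open>auto simp: indicator_def\<close>)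
    qed
    also have "\<dots> = ennreal e" by (simp add: nn_integral_cmult_indicator)
    finally show "finsler_dist ?M \<Phi> p q \<le> ennreal e" .
  qed
qed

section \<open>The sup metric\<close>

lemma id_chart_in_atlas: "(UNIV, id) \<in> atlas (standard_manifold (UNIV :: (real ^ 'n::finite) set))"
proof -
  have "openin (top_of_set (sector {})) (UNIV :: (real ^ 'n) set)" by (simp add: sector_def)
  then have "(UNIV, \<lambda>x. x + 0) \<in> atlas (standard_manifold (UNIV :: (real ^ 'n) set))"
    by (intro affine_chart_in_atlas[where K="\<lambda>x. x" and L="\<lambda>x. x" and I="{}"]) (auto simp: linear_iff)
  then show ?thesis by (simp add: id_def)
qed

lemma smooth_manifold_UNIV: "smooth_manifold (standard_manifold (UNIV :: (real ^ 'n::finite) set))"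
  by (rule smooth_manifold_standard) (use id_chart_in_atlas in force)

lemma id_chart_at: "(UNIV, id) \<in> charts_at (standard_manifold (UNIV :: (real ^ 'n::finite) set)) p"
  using id_chart_in_atlas by (simp add: charts_at_def)

text \<open>Near a point the derivative within \<open>S\<close> is that of a smooth extension, by
  uniqueness in sectors. Expanding \<open>w\<close> in the basis reduces joint continuity to that of
  the partial derivatives.\<close>

lemma continuous_on_smooth_derivative:
  fixes f :: "real ^ 'n::finite \<Rightarrow> 'b::real_normed_vector"
  assumes "openin (top_of_set (sector I)) S" "smooth_on S f"
  shows "continuous_on (S \<times> UNIV) (\<lambda>(x, w). frechet_derivative f (at x within S) w)"
  unfolding continuous_on_eq_continuous_within
proof
  fix z assume "z \<in> S \<times> (UNIV :: (real ^ 'n) set)"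
  then obtain x w where z: "z = (x, w)" "x \<in> S" by auto
  obtain W g where W: "open W" "x \<in> W" "\<forall>k. C_k_on k W g" "\<forall>y\<in>S \<inter> W. g y = f y"
    using smooth_onE[OF assms(2) z(2)] .
  have eq: "frechet_derivative f (at y within S) = frechet_derivative g (at y)" if y: "y \<in> S \<inter> W" for y
  proof -
    have w: "at y within (S \<inter> W) = at y within S"
      by (rule at_within_nhd[of _ W]) (use y W in auto)
    have "(g has_derivative frechet_derivative g (at y)) (at y within (S \<inter> W))"
      using C_k_on_has_derivative[OF spec[OF W(3)]] y by (blast intro: has_derivative_at_withinI)
    then have "(f has_derivative frechet_derivative g (at y)) (at y within (S \<inter> W))"
      by (rule has_derivative_transform[rotated 2]) (use y W in auto)
    then have g: "(f has_derivative frechet_derivative g (at y)) (at y within S)" unfolding w .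
    then have "(f has_derivative frechet_derivative f (at y within S)) (at y within S)"
      using frechet_derivative_works differentiable_def by blast
    from has_derivative_unique_sector[OF assms(1) _ this g] y show ?thesis by blast
  qed
  have "continuous_on (W \<times> UNIV) (\<lambda>(x, w). \<Sum>i\<in>Basis. (w \<bullet> i) *\<^sub>R frechet_derivative g (at x) i)"
  proof -
    have "continuous_on W (\<lambda>x. frechet_derivative g (at x) i)" for i
      using spec[OF W(3), of "Suc 0"] by simp
    then have "continuous_on (W \<times> UNIV) (\<lambda>z :: (real ^ 'n) \<times> (real ^ 'n). frechet_derivative g (at (fst z)) i)" for i
      by (rule continuous_on_compose2) (auto intro: continuous_intros)
    then show ?thesis unfolding case_prod_beta by (intro continuous_intros)
  qed
  then have "isCont (\<lambda>(x, w). \<Sum>i\<in>Basis. (w \<bullet> i) *\<^sub>R frechet_derivative g (at x) i) z"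
    using W(1,2) z continuous_on_eq_continuous_at[of "W \<times> UNIV"] by (auto simp: open_Times)
  then have "continuous (at z within S \<times> UNIV) (\<lambda>(x, w). \<Sum>i\<in>Basis. (w \<bullet> i) *\<^sub>R frechet_derivative g (at x) i)"
    by (rule continuous_at_imp_continuous_at_within)
  then show "continuous (at z within S \<times> UNIV) (\<lambda>(x, w). frechet_derivative f (at x within S) w)"
  proof (rule continuous_transform_within_openin[where S="(S \<times> UNIV) \<inter> (W \<times> UNIV)"])
    show "openin (top_of_set (S \<times> UNIV)) ((S \<times> UNIV) \<inter> (W \<times> UNIV))"
      using W(1) by (intro openin_open_Int open_Times) auto
    show "z \<in> (S \<times> UNIV) \<inter> (W \<times> UNIV)" using z W by auto
    fix y assume y: "y \<in> (S \<times> UNIV) \<inter> (W \<times> (UNIV :: (real ^ 'n) set))"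
    have "(\<Sum>i\<in>Basis. (snd y \<bullet> i) *\<^sub>R frechet_derivative g (at (fst y)) i) = frechet_derivative g (at (fst y)) (snd y)"
      using linear_eq_sum_Basis[OF has_derivative_linear[OF C_k_on_has_derivative[OF spec[OF W(3)]]], of "fst y" "snd y"] y by auto
    then show "(case y of (x, w) \<Rightarrow> \<Sum>i\<in>Basis. (w \<bullet> i) *\<^sub>R frechet_derivative g (at x) i)
        = (case y of (x, w) \<Rightarrow> frechet_derivative f (at x within S) w)"
      using eq[of "fst y"] y by (simp add: case_prod_beta mem_Times_iff)
  qed
qed

text \<open>A tangent vector is determined by its coordinates in the identity chart, which gives
  definiteness. In terms of another chart \<open>c\<close> these coordinates are the derivative of
  \<open>chart_inv c\<close> applied to \<open>w\<close>, which gives continuity.\<close>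

lemma finsler_metric_sup_metric:
  "finsler_metric (standard_manifold (UNIV :: (real ^ 'n::finite) set)) sup_metric"
  unfolding finsler_metric_def
proof (intro conjI ballI)
  let ?M = "standard_manifold (UNIV :: (real ^ 'n) set)"
  fix p :: "real ^ 'n"
  have "\<xi> = (\<lambda>c. 0)" if "\<xi> \<in> tangent_space ?M p" "\<xi> (UNIV, id) = 0" for \<xi>
  proof -
    have "\<xi> = tangent_vec ?M (UNIV, id) p (\<xi> (UNIV, id))"
      using that(1) id_chart_at[of p] unfolding tangent_space_def by blast
    then show ?thesis using tangent_vec_0[OF smooth_manifold_UNIV id_chart_at] that(2) by simp
  qed
  then show "asymmetric_norm_on (tangent_space ?M p) (sup_metric p)"
    unfolding asymmetric_norm_on_def sup_metric_def
    by (auto simp: infnorm_pos_le infnorm_eq_0 infnorm_mul infnorm_triangle)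
next
  let ?M = "standard_manifold (UNIV :: (real ^ 'n) set)"
  fix c assume c: "c \<in> atlas ?M"
  then obtain I where I: "openin (top_of_set (sector I)) (snd c ` fst c)"
    and sm: "smooth_on (snd c ` fst c) (chart_inv c)" and inj: "inj_on (snd c) (fst c)"
    unfolding atlas_standard by blast
  have "continuous_on ((snd c ` fst c) \<times> UNIV)
      (\<lambda>z. infnorm ((\<lambda>(x, w). frechet_derivative (chart_inv c) (at x within snd c ` fst c) w) z))"
    by (rule continuous_on_infnorm[OF continuous_on_smooth_derivative[OF I sm]])
  then show "continuous_on ((snd c ` fst c) \<times> UNIV)
      (\<lambda>(x, w). sup_metric (chart_inv c x) (tangent_vec ?M c (chart_inv c x) w))"
  proof (rule continuous_on_eq)
    fix z assume "z \<in> (snd c ` fst c) \<times> (UNIV :: (real ^ 'n) set)"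
    then show "infnorm ((\<lambda>(x, w). frechet_derivative (chart_inv c) (at x within snd c ` fst c) w) z) =
      (case z of (x, w) \<Rightarrow> sup_metric (chart_inv c x) (tangent_vec ?M c (chart_inv c x) w))"
      using id_chart_at chart_inv_works[of "fst z" c]
      by (auto simp: sup_metric_def tangent_vec_def case_prod_beta)
  qed
qed

lemma reversible_sup_metric: "reversible (standard_manifold (UNIV :: (real ^ 'n::finite) set)) sup_metric"
  by (simp add: reversible_def sup_metric_def infnorm_neg)

text \<open>Shortness of a map asks for upper bounds of the target distance; a straight segment
  supplies one.\<close>

lemma finsler_dist_sup_metric_le:
  fixes x y :: "real ^ 'n::finite"
  shows "finsler_dist (standard_manifold UNIV) sup_metric x y \<le> ennreal (infnorm (y - x))"
proof -
  let ?M = "standard_manifold (UNIV :: (real ^ 'n) set)" and ?\<sigma> = "\<lambda>t. x + t *\<^sub>R (y - x)"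
  have "pw_C1 ?M ?\<sigma> 0 1" by (intro pw_C1.piece C1_curve_on_segment) auto
  then have "finsler_dist ?M sup_metric x y \<le> seg_length ?M sup_metric ?\<sigma> 0 1"
    by (rule finsler_dist_le) auto
  also have "\<dots> = (\<integral>\<^sup>+t\<in>{0..1::real}. ennreal (infnorm (y - x)) \<partial>lborel)"
  proof -
    have "vector_derivative ?\<sigma> (at t) = y - x" for t
      by (rule vector_derivative_at) (auto intro!: derivative_eq_intros simp: has_vector_derivative_def)
    then show ?thesis
      by (simp add: seg_length_def speed_def sup_metric_def velocity_def id_chart_at)
  qed
  also have "\<dots> = ennreal (infnorm (y - x))" by (simp add: nn_integral_cmult_indicator)
  finally show ?thesis .
qed

section \<open>Parallelotopes\<close>

text \<open>\<open>h\<close> moves \<open>t\<close> by \<open>- g t\<close> and clamps the result to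
  the cube, so Brouwer's theorem gives a fixed point. There a nonzero \<open>g t $ i\<close> could
  be hidden only by clamping, with a positive value at \<open>t $ i = 0\<close> or a negative one at
  \<open>t $ i = 1\<close>; the sign conditions exclude both.\<close>

lemma poincare_miranda:
  fixes g :: "real ^ 'n::finite \<Rightarrow> real ^ 'n"
  assumes cont: "continuous_on (cbox 0 1) g"
    and le: "\<And>t i. t \<in> cbox 0 1 \<Longrightarrow> t $ i = 0 \<Longrightarrow> g t $ i \<le> 0"
    and ge: "\<And>t i. t \<in> cbox 0 1 \<Longrightarrow> t $ i = 1 \<Longrightarrow> 0 \<le> g t $ i"
  shows "\<exists>t\<in>cbox 0 1. g t = 0"
proof -
  define h where "h t = (\<chi> i. max 0 (min 1 (t $ i - g t $ i)))" for t
  have "continuous_on (cbox 0 1) h"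
    unfolding h_def using cont by (intro continuous_intros)
  moreover have "h \<in> cbox 0 1 \<rightarrow> cbox 0 1" by (auto simp: h_def mem_box_cart)
  moreover have "cbox 0 1 \<noteq> ({} :: (real ^ 'n) set)" by (simp add: interval_ne_empty_cart)
  ultimately obtain t where t: "t \<in> cbox 0 1" "h t = t"
    using brouwer[of "cbox 0 1" h] by (metis compact_cbox convex_box(1))
  have "g t $ i = 0" for i
  proof -
    have "max 0 (min 1 (t $ i - g t $ i)) = t $ i" using t(2) by (metis h_def vec_lambda_beta)
    moreover have "0 \<le> t $ i" "t $ i \<le> 1" using t(1) by (auto simp: mem_box_cart)
    ultimately show ?thesis using le[OF t(1), of i] ge[OF t(1), of i]
      by (auto simp: max_def min_def split: if_splits)
  qed
  then show ?thesis using t(1) by (intro bexI[of _ t]) (auto simp: vec_eq_iff)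
qed

section \<open>Parallelotopes as affine images of the cube\<close>

lemma parallelotope_eq_image:
  "parallelotope a b = (\<lambda>t. a + (\<Sum>i\<in>UNIV. t $ i *\<^sub>R b i)) ` cbox 0 1" (is "_ = ?f ` _")
proof (intro subset_antisym subsetI)
  fix x assume "x \<in> parallelotope a b"
  then obtain t where "x = a + (\<Sum>i\<in>UNIV. t i *\<^sub>R b i)" "\<forall>i. t i \<in> {0..1}"
    unfolding parallelotope_def by blast
  then show "x \<in> ?f ` cbox 0 1" by (intro image_eqI[of _ _ "vec_lambda t"]) (auto simp: mem_box_cart)
qed (auto simp: parallelotope_def mem_box_cart)

lemma mem_parallelotope_face:
  "t \<in> cbox 0 1 \<Longrightarrow> t $ i = s \<Longrightarrow> a + (\<Sum>i\<in>UNIV. t $ i *\<^sub>R b i) \<in> parallelotope_face a b i s"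
  by (auto simp: parallelotope_face_def mem_box_cart)

lemma parallelotope_face_subset: "parallelotope_face a b i s \<subseteq> parallelotope a b"
  by (auto simp: parallelotope_face_def parallelotope_def)

lemma linear_sum_scaleR_component: "linear (\<lambda>t :: real ^ 'n::finite. \<Sum>i\<in>UNIV. t $ i *\<^sub>R b i)"
  by (intro linearI) (simp_all add: scaleR_left_distrib sum.distrib scaleR_sum_right)

lemma convex_parallelotope: "convex (parallelotope a b)"
  using convex_translation[OF convex_linear_image[OF linear_sum_scaleR_component convex_box(1)]]
  unfolding parallelotope_eq_image image_image .

lemma compact_parallelotope: "compact (parallelotope a b)"
  unfolding parallelotope_eq_image by (intro compact_continuous_image continuous_intros compact_cbox)

lemma independent_coordinates:
  fixes b :: "'n::finite \<Rightarrow> real ^ 'n"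
  assumes "inj b" "independent (range b)"
  obtains K :: "real ^ 'n \<Rightarrow> real ^ 'n" where "linear K"
    "\<And>t. K (\<Sum>i\<in>UNIV. t $ i *\<^sub>R b i) = t" "\<And>x. (\<Sum>i\<in>UNIV. K x $ i *\<^sub>R b i) = x"
proof -
  let ?L = "\<lambda>t :: real ^ 'n. \<Sum>i\<in>UNIV. t $ i *\<^sub>R b i"
  have "t = 0" if "?L t = 0" for t
  proof -
    \<comment> \<open>Independence concerns coefficients indexed by vectors; injectivity of
      \<open>b\<close> allows reindexing by \<open>inv b\<close>.\<close>
    have "(\<Sum>v\<in>range b. (t $ inv b v) *\<^sub>R v) = ?L t"
      using assms(1) by (simp add: sum.reindex)
    then have "(\<Sum>v\<in>range b. (t $ inv b v) *\<^sub>R v) = 0" using that by (rule trans)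
    moreover have "\<forall>c. (\<Sum>v\<in>range b. c v *\<^sub>R v) = 0 \<longrightarrow> (\<forall>v\<in>range b. c v = 0)"
      using assms(2) unfolding independent_explicit by (rule conjunct2)
    from spec[OF this, of "\<lambda>v. t $ inv b v"]
    have "(\<Sum>v\<in>range b. (t $ inv b v) *\<^sub>R v) = 0 \<longrightarrow> (\<forall>v\<in>range b. t $ inv b v = 0)" .
    ultimately have "\<forall>v\<in>range b. t $ inv b v = 0" by (rule rev_mp)
    then show "t = 0" using assms(1) by (simp add: vec_eq_iff)
  qed
  then have "inj ?L"
    using linear_injective_0[OF linear_sum_scaleR_component[of b]] by blast
  from linear_injective_isomorphism[OF linear_sum_scaleR_component this] that
  show thesis by blast
qed

text \<open>Reflecting the coordinates that are equal to 1 at \<open>p\<close> moves every point of the cube away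
  from the faces \<open>t\<^sub>i = 1\<close>, so that the sector with all coordinates nonnegative is a local model everywhere.\<close>
lemma parallelotope_affine_chart:
  fixes b :: "'n::finite \<Rightarrow> real ^ 'n"
  assumes "inj b" "independent (range b)" "p \<in> parallelotope a b"
  shows "\<exists>U K k. p \<in> U \<and> convex U \<and> linear K \<and>
    (U, \<lambda>x. K x + k) \<in> atlas (standard_manifold (parallelotope a b))"
proof -
  let ?P = "parallelotope a b"
  let ?L = "\<lambda>t :: real ^ 'n. \<Sum>i\<in>UNIV. t $ i *\<^sub>R b i"
  obtain K where K: "linear K" "\<And>t. K (?L t) = t" "\<And>x. ?L (K x) = x"
    using independent_coordinates[OF assms(1,2)] by metis
  obtain q where q: "q \<in> cbox 0 1" "p = a + ?L q"
    using assms(3) unfolding parallelotope_eq_image by blast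
  \<comment> \<open>\<open>D t + r\<close> replaces \<open>t $ i\<close> by \<open>1 - t $ i\<close>
    exactly where \<open>q $ i = 1\<close>. Since \<open>D r = - r\<close>, this is an involution,
    which inverts the chart explicitly.\<close>
  define \<epsilon> :: "'n \<Rightarrow> real" where "\<epsilon> i = (if q $ i = 1 then -1 else 1)" for i
  define D where "D t = (\<chi> i. \<epsilon> i * t $ i)" for t :: "real ^ 'n"
  define r :: "real ^ 'n" where "r = (\<chi> i. if q $ i = 1 then 1 else 0)"
  have D: "linear D" "D (D t) = t" "D r = - r" for t
    by (auto intro!: linearI simp: D_def r_def \<epsilon>_def vec_eq_iff algebra_simps)
  have cube: "D t + r \<in> cbox 0 1" if "t \<in> cbox 0 1" for t
    using that by (auto simp: D_def r_def \<epsilon>_def mem_box_cart)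
  define k where "k = r - D (K a)"
  define c where "c x = D (K x) + k" for x
  have c: "c (a + ?L t) = D t + r" for t
    by (simp add: c_def k_def linear_add[OF K(1)] linear_add[OF D(1)] K(2))
  have c_surj: "c (a + ?L (D t + r)) = t" for t
    unfolding c linear_add[OF D(1)] D by simp
  have linDK: "linear (\<lambda>x. D (K x))" using linear_compose[OF K(1) D(1)] by (simp add: o_def)
  \<comment> \<open>Removing the faces with coordinate 1 leaves a set whose image is relatively open
    in the sector. The point \<open>p\<close> survives: its reflected coordinates are 0 and the
    others are below 1.\<close>
  define V where "V = {x. \<forall>i. c x $ i < 1}"
  have "open V"
  proof -
    have "continuous_on UNIV c"
      unfolding c_def by (intro continuous_intros linear_continuous_on) (use linDK in \<open>simp add: linear_conv_bounded_linear\<close>)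
    then have "open (\<Inter>i. {x. c x $ i < 1})"
      by (intro open_INT ballI open_Collect_less continuous_intros) auto
    then show ?thesis by (simp add: V_def Collect_all_eq)
  qed
  have convV: "convex V"
  proof (rule convexI)
    fix x y u v assume xy: "x \<in> V" "y \<in> V" and uv: "0 \<le> u" "0 \<le> v" "u + v = (1 :: real)"
    have "c (u *\<^sub>R x + v *\<^sub>R y) = u *\<^sub>R c x + v *\<^sub>R c y"
    proof -
      have "k = u *\<^sub>R k + v *\<^sub>R k" using uv(3) by (metis scaleR_left_distrib scaleR_one)
      then show ?thesis
        by (simp add: c_def linear_add[OF linDK] linear_scale[OF linDK] scaleR_right_distrib)
    qed
    then show "u *\<^sub>R x + v *\<^sub>R y \<in> V"
      using xy uv by (auto simp: V_def intro!: convex_bound_lt)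
  qed
  have image: "c ` (?P \<inter> V) = sector UNIV \<inter> {t. \<forall>i. t $ i < 1}"
  proof (intro subset_antisym subsetI)
    fix t assume "t \<in> c ` (?P \<inter> V)"
    then obtain s where s: "s \<in> cbox 0 1" "t = c (a + ?L s)" "a + ?L s \<in> V"
      unfolding parallelotope_eq_image by blast
    then have "t \<in> cbox 0 1" using cube by (simp add: c)
    then show "t \<in> sector UNIV \<inter> {t. \<forall>i. t $ i < 1}"
      using s(2,3) by (auto simp: sector_def V_def mem_box_cart)
  next
    fix t :: "real ^ 'n" assume t: "t \<in> sector UNIV \<inter> {t. \<forall>i. t $ i < 1}"
    then have "t \<in> cbox 0 1" by (auto simp: sector_def mem_box_cart less_imp_le)
    then have "a + ?L (D t + r) \<in> ?P" unfolding parallelotope_eq_image using cube by blast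
    moreover have "a + ?L (D t + r) \<in> V" using t c_surj by (auto simp: V_def)
    ultimately show "t \<in> c ` (?P \<inter> V)" by (intro image_eqI[where x="a + ?L (D t + r)"] c_surj[symmetric] IntI)
  qed
  have "(?P \<inter> V, \<lambda>x. D (K x) + k) \<in> atlas (standard_manifold ?P)"
  proof (rule affine_chart_in_atlas[where L="\<lambda>t. ?L (D t)" and I=UNIV])
    show "linear (\<lambda>t. ?L (D t))"
      using linear_compose[OF D(1) linear_sum_scaleR_component[of b]] by (simp add: o_def)
    show "openin (top_of_set ?P) (?P \<inter> V)" using \<open>open V\<close> by (rule openin_open_Int)
    have "open (\<Inter>i. {t :: real ^ 'n. t $ i < 1})"
      by (intro open_INT ballI open_Collect_less continuous_intros) auto
    then have "open {t :: real ^ 'n. \<forall>i. t $ i < 1}" by (simp add: Collect_all_eq)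
    then show "openin (top_of_set (sector UNIV)) ((\<lambda>x. D (K x) + k) ` (?P \<inter> V))"
      using image unfolding c_def by (simp add: openin_open_Int)
  qed (simp_all add: linDK D K)
  moreover have "p \<in> V"
  proof -
    have "c p = D q + r" unfolding q(2) by (rule c)
    then show ?thesis
      using q(1) by (auto simp: V_def D_def r_def \<epsilon>_def mem_box_cart order.strict_iff_order)
  qed
  ultimately show ?thesis
    using assms(3) convex_Int[OF convex_parallelotope convV] linDK by blast
qed

lemma finsler_dist_self:
  assumes "\<And>e. 0 < e \<Longrightarrow> \<exists>\<delta>>0. \<forall>q\<in>S. dist p q < \<delta> \<longrightarrow> finsler_dist M \<Phi> p q \<le> ennreal e" "p \<in> S"
  shows "finsler_dist M \<Phi> p p = 0"
proof -
  have "finsler_dist M \<Phi> p p \<le> 0"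
    by (rule ennreal_le_epsilon) (use assms in force)
  then show ?thesis by simp
qed

section \<open>Distance functions of subsets of a connected domain\<close>

text \<open>This isolates the properties of a parallelotope that the distance functions rely on;
  \<open>small\<close> compares the Finsler distance with the Euclidean topology.\<close>

locale finsler_domain =
  fixes S :: "(real ^ 'n::finite) set" and \<Phi> :: "(real ^ 'n, 'n) metric"
  assumes M: "smooth_manifold (standard_manifold S)"
    and \<Phi>: "finsler_metric (standard_manifold S) \<Phi>" "reversible (standard_manifold S) \<Phi>"
    and conn: "connected S"
    and small: "\<And>p e. p \<in> S \<Longrightarrow> 0 < e \<Longrightarrow>
      \<exists>\<delta>>0. \<forall>q\<in>S. dist p q < \<delta> \<longrightarrow> finsler_dist (standard_manifold S) \<Phi> p q \<le> ennreal e"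
begin

abbreviation "fdist \<equiv> finsler_dist (standard_manifold S) \<Phi>"

lemmas fdist_triangle = finsler_dist_triangle[OF M \<Phi>]
lemmas fdist_commute = finsler_dist_commute[OF M \<Phi>]

lemma fdist_self: "p \<in> S \<Longrightarrow> fdist p p = 0"
  by (rule finsler_dist_self[OF small])

text \<open>Finiteness of the distance from \<open>p\<close> is locally constant, since by
  \<open>small\<close> nearby points have distance at most 1 and the triangle inequality transfers
  finiteness both ways. It holds at \<open>p\<close>, and \<open>S\<close> is connected.\<close>

lemma fdist_finite:
  assumes p: "p \<in> S" and "q \<in> S"
  shows "fdist p q < \<infinity>"
proof -
  let ?A = "{x\<in>S. fdist p x < \<infinity>}"
  have near: "\<exists>\<delta>>0. \<forall>y\<in>S. dist x y < \<delta> \<longrightarrow> (fdist p x < \<infinity> \<longleftrightarrow> fdist p y < \<infinity>)" if x: "x \<in> S" for x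
  proof -
    obtain \<delta> where \<delta>: "\<delta> > 0" "\<forall>y\<in>S. dist x y < \<delta> \<longrightarrow> fdist x y \<le> ennreal 1"
      using small[OF x, of 1] by auto
    have "fdist p x < \<infinity> \<longleftrightarrow> fdist p y < \<infinity>" if "y \<in> S" "dist x y < \<delta>" for y
    proof -
      have "fdist x y < \<infinity>" using \<delta>(2) that by (auto intro: le_less_trans)
      then have "fdist p x + fdist x y < \<infinity> \<longleftrightarrow> fdist p x < \<infinity>" "fdist p y + fdist y x < \<infinity> \<longleftrightarrow> fdist p y < \<infinity>"
        using fdist_commute[of x y] by auto
      then show ?thesis using fdist_triangle[of p y x] fdist_triangle[of p x y] by (metis le_less_trans)
    qed
    then show ?thesis using \<delta>(1) by blast
  qed
  \<comment> \<open>Stated for any set invariant under this equivalence, so that it serves the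
    points at finite distance and their complement.\<close>
  have op: "openin (top_of_set S) B"
    if B: "B \<subseteq> S" "\<And>x y. x \<in> B \<Longrightarrow> y \<in> S \<Longrightarrow> (fdist p x < \<infinity> \<longleftrightarrow> fdist p y < \<infinity>) \<Longrightarrow> y \<in> B" for B
    unfolding openin_contains_ball
  proof (intro conjI ballI)
    fix x assume x: "x \<in> B"
    obtain \<delta> where "\<delta> > 0" "\<forall>y\<in>S. dist x y < \<delta> \<longrightarrow> (fdist p x < \<infinity> \<longleftrightarrow> fdist p y < \<infinity>)"
      using near x B(1) by blast
    then show "\<exists>\<epsilon>>0. ball x \<epsilon> \<inter> S \<subseteq> B"
      using B(2)[OF x] by (intro exI[of _ \<delta>]) auto
  qed (rule B)
  have "openin (top_of_set S) ?A" "openin (top_of_set S) (S - ?A)"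
    by (rule op; auto)+
  then have "closedin (top_of_set S) ?A" unfolding closedin_def by auto
  moreover have "p \<in> ?A" using p fdist_self by simp
  ultimately have "?A = S"
    using conn \<open>openin (top_of_set S) ?A\<close> unfolding connected_clopen by blast
  then show ?thesis using assms by blast
qed

text \<open>Real values are wanted as coordinates of a map. \<open>enn2real\<close> sends
  \<infinity> to 0, but for nonempty \<open>F \<subseteq> S\<close> and \<open>x \<in> S\<close> the
  set distance is finite.\<close>

definition dist_from :: "(real ^ 'n) set \<Rightarrow> real ^ 'n \<Rightarrow> real" where
  "dist_from F x = enn2real (finsler_setdist (standard_manifold S) \<Phi> F {x})"

lemma ennreal_dist_from:
  assumes "F \<subseteq> S" "F \<noteq> {}" "x \<in> S"
  shows "ennreal (dist_from F x) = (INF u\<in>F. fdist u x)"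
proof -
  obtain u where u: "u \<in> F" using assms by blast
  have "(INF u\<in>F. fdist u x) \<le> fdist u x" using u by (rule INF_lower)
  also have "\<dots> < \<infinity>" using fdist_finite u assms by blast
  finally show ?thesis by (simp add: dist_from_def finsler_setdist_def)
qed

lemma dist_from_0:
  assumes "F \<subseteq> S" "x \<in> F"
  shows "dist_from F x = 0"
proof -
  have "(INF u\<in>F. fdist u x) \<le> fdist x x" using assms by (intro INF_lower)
  then show ?thesis using fdist_self assms by (auto simp: dist_from_def finsler_setdist_def)
qed

lemma dist_from_lipschitz:
  assumes F: "F \<subseteq> S" "F \<noteq> {}" and "x \<in> S" "y \<in> S"
  shows "ennreal \<bar>dist_from F y - dist_from F x\<bar> \<le> fdist x y"
proof -
  have *: "ennreal (dist_from F y - dist_from F x) \<le> fdist x y" if xy: "x \<in> S" "y \<in> S" for x y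
  proof -
    obtain r where r: "fdist x y = ennreal r" "0 \<le> r"
      using fdist_finite[OF xy] by (cases "fdist x y") auto
    \<comment> \<open>The infimum over \<open>{()}\<close> presents the constant
      \<open>fdist x y\<close> as an infimum, to fit the lemma on sums of infima.\<close>
    have "ennreal (dist_from F y) \<le> (INF u\<in>F. fdist u x) + (INF i\<in>{()}. fdist x y)"
      unfolding ennreal_dist_from[OF F xy(2)]
    proof (rule le_add_INF_ennreal)
      fix u assume "u \<in> F"
      then have "(INF u\<in>F. fdist u y) \<le> fdist u y" by (rule INF_lower)
      also have "\<dots> \<le> fdist u x + fdist x y" by (rule fdist_triangle)
      finally show "(INF u\<in>F. fdist u y) \<le> fdist u x + fdist x y" .
    qed
    also have "\<dots> = ennreal (dist_from F x + r)"
      using r ennreal_dist_from[OF F xy(1)] by (simp add: dist_from_def ennreal_plus)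
    finally have "dist_from F y \<le> dist_from F x + r"
      using r by (subst (asm) ennreal_le_iff) (auto simp: dist_from_def)
    then show ?thesis unfolding r by (intro ennreal_leI) simp
  qed
  show ?thesis
    using *[OF assms(3,4)] *[OF assms(4,3)] fdist_commute[of x y] by (auto simp: abs_if)
qed

lemma continuous_on_dist_from:
  assumes F: "F \<subseteq> S" "F \<noteq> {}"
  shows "continuous_on S (dist_from F)"
  unfolding continuous_on_iff
proof (intro ballI allI impI)
  fix x :: "real ^ 'n" and e :: real assume x: "x \<in> S" and e: "0 < e"
  then obtain \<delta> where \<delta>: "\<delta> > 0" "\<forall>y\<in>S. dist x y < \<delta> \<longrightarrow> fdist x y \<le> ennreal (e / 2)"
    using small[OF x, of "e / 2"] by auto
  have "dist (dist_from F y) (dist_from F x) < e" if y: "y \<in> S" "dist y x < \<delta>" for y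
  proof -
    have "ennreal \<bar>dist_from F y - dist_from F x\<bar> \<le> ennreal (e / 2)"
      using dist_from_lipschitz[OF F x y(1)] \<delta>(2) y by (auto simp: dist_commute intro: order_trans)
    then have "\<bar>dist_from F y - dist_from F x\<bar> \<le> e / 2"
      using e by (subst (asm) ennreal_le_iff) auto
    then show ?thesis using e by (simp add: dist_real_def)
  qed
  then show "\<exists>\<delta>>0. \<forall>y\<in>S. dist y x < \<delta> \<longrightarrow> dist (dist_from F y) (dist_from F x) < e"
    using \<delta>(1) by blast
qed

text \<open>The sup norm of the difference is attained at some coordinate, where the Lipschitz bound
  for a single subset applies.\<close>

lemma dist_from_short:
  assumes F: "\<And>i. F i \<subseteq> S" "\<And>i. F i \<noteq> {}" and "x \<in> S" "y \<in> S"
  shows "finsler_dist (standard_manifold UNIV) sup_metric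
    (\<chi> i. dist_from (F i) x) (\<chi> i. dist_from (F i) y :: real ^ 'n) \<le> fdist x y"
proof -
  let ?f = "\<lambda>x. \<chi> i :: 'n. dist_from (F i) x"
  have "infnorm (?f y - ?f x) \<in> (\<lambda>b. \<bar>(?f y - ?f x) \<bullet> b\<bar>) ` Basis"
    unfolding infnorm_Max by (intro Max_in) auto
  then obtain i where "infnorm (?f y - ?f x) = \<bar>dist_from (F i) y - dist_from (F i) x\<bar>"
    by (auto simp: Basis_vec_def inner_axis)
  then have "ennreal (infnorm (?f y - ?f x)) \<le> fdist x y"
    using dist_from_lipschitz[OF F assms(3,4)] by simp
  then show ?thesis using finsler_dist_sup_metric_le by (rule order_trans[rotated])
qed

end

section \<open>The parallelotope as a domain and the volume inequality\<close>

lemma finsler_domain_parallelotope: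
  fixes b :: "'n::finite \<Rightarrow> real ^ 'n"
  assumes "inj b" "independent (range b)"
    and \<Phi>: "finsler_metric (standard_manifold (parallelotope a b)) \<Phi>"
      "reversible (standard_manifold (parallelotope a b)) \<Phi>"
  shows "finsler_domain (parallelotope a b) \<Phi>"
proof
  note chart = parallelotope_affine_chart[OF assms(1,2)]
  show M: "smooth_manifold (standard_manifold (parallelotope a b))"
  proof (rule smooth_manifold_standard)
    fix p :: "real ^ 'n" assume "p \<in> parallelotope a b"
    from chart[OF this] show "\<exists>c\<in>atlas (standard_manifold (parallelotope a b)). p \<in> fst c"
      by (metis fst_conv)
  qed
  show "connected (parallelotope a b)" by (rule convex_connected[OF convex_parallelotope])
  fix p :: "real ^ 'n" and e :: real assume p: "p \<in> parallelotope a b" and e: "0 < e"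
  obtain U K k where c: "p \<in> U" "convex U" "linear K"
    "(U, \<lambda>x. K x + k) \<in> atlas (standard_manifold (parallelotope a b))"
    using chart[OF p] by blast
  show "\<exists>\<delta>>0. \<forall>q\<in>parallelotope a b. dist p q < \<delta> \<longrightarrow>
      finsler_dist (standard_manifold (parallelotope a b)) \<Phi> p q \<le> ennreal e"
    by (rule finsler_dist_segment_small[OF M \<Phi>(1) c(3,4,1,2) e])
qed (rule \<Phi>)+

lemma finsler_volume_sets:
  assumes v: "finsler_volume v"
    and M: "smooth_manifold M" "finsler_metric M \<Phi>" "reversible M \<Phi>"
  shows "sets (v M \<Phi>) = sigma_sets (topspace (mtop M)) {U. openin (mtop M) U}"
proof -
  note sets = v[unfolded finsler_volume_def Let_def, THEN conjunct1, rule_format]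
  show ?thesis by (rule sets[THEN conjunct2]) (intro conjI M)
qed

lemma finsler_volume_short_map:
  assumes v: "finsler_volume v"
    and M: "smooth_manifold M" "finsler_metric M \<Phi>" "reversible M \<Phi>"
    and N: "smooth_manifold N" "finsler_metric N \<Psi>" "reversible N \<Psi>"
    and f: "f \<in> topspace (mtop M) \<rightarrow> topspace (mtop N)"
    and short: "\<And>x y. x \<in> topspace (mtop M) \<Longrightarrow> y \<in> topspace (mtop M) \<Longrightarrow>
      finsler_dist N \<Psi> (f x) (f y) \<le> finsler_dist M \<Phi> x y"
  shows "emeasure (v N \<Psi>) (f ` topspace (mtop M)) \<le> emeasure (v M \<Phi>) (topspace (mtop M))"
proof -
  note mono = v[unfolded finsler_volume_def Let_def, THEN conjunct2, THEN conjunct2, THEN conjunct2, rule_format]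
  show ?thesis by (rule mono[OF conjI[OF M(1) conjI[OF M(2,3)]] conjI[OF N(1) conjI[OF N(2,3)]] f short])
qed

theorem proposition3p1:
  fixes a :: "real ^ 'n::finite" and b :: "'n \<Rightarrow> real ^ 'n"
    and P :: "(real ^ 'n) set"
    and \<Phi> :: "(real ^ 'n, 'n) metric"
    and F G :: "'n \<Rightarrow> (real ^ 'n) set"
    and d :: "'n \<Rightarrow> ennreal"
    and v :: "(real ^ 'n, 'n) manifold \<Rightarrow> (real ^ 'n, 'n) metric \<Rightarrow> (real ^ 'n) measure"
  assumes "inj b" and "independent (range b)"
    and P: "P = parallelotope a b"
    and "finsler_metric (standard_manifold P) \<Phi>"
    and "reversible (standard_manifold P) \<Phi>"
    and F: "\<And>i. F i = parallelotope_face a b i 0"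
    and G: "\<And>i. G i = parallelotope_face a b i 1"
    and d: "\<And>i. d i = finsler_setdist (standard_manifold P) \<Phi> (F i) (G i)"
    and "finsler_volume v"
  shows "emeasure (v (standard_manifold P) \<Phi>) P \<ge>
         emeasure (v (standard_manifold UNIV) sup_metric)
           {x. \<forall>i. 0 \<le> x $ i \<and> ennreal (x $ i) \<le> d i}"
proof -
  interpret finsler_domain P \<Phi>
    unfolding P using assms by (intro finsler_domain_parallelotope) simp_all
  let ?B = "\<lambda>t :: real ^ 'n. a + (\<Sum>i\<in>UNIV. t $ i *\<^sub>R b i)"
  define f where "f x = (\<chi> i. dist_from (F i) x)" for x :: "real ^ 'n"
  have FP: "F i \<subseteq> P" for i unfolding F P by (rule parallelotope_face_subset)
  have FN: "F i \<noteq> {}" for i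
    using mem_parallelotope_face[of 0 i 0 a b] unfolding F by (auto simp: mem_box_cart)
  have BP: "?B t \<in> P" if "t \<in> cbox 0 1" for t
    unfolding P parallelotope_eq_image using that by blast
  have cont: "continuous_on P f"
    unfolding f_def by (intro continuous_on_vec_lambda continuous_on_dist_from FP FN)
  have box: "{x. \<forall>i. 0 \<le> x $ i \<and> ennreal (x $ i) \<le> d i} \<subseteq> f ` P"
  proof
    fix x assume "x \<in> {x. \<forall>i. 0 \<le> x $ i \<and> ennreal (x $ i) \<le> d i}"
    then have x: "0 \<le> x $ i" "ennreal (x $ i) \<le> d i" for i by auto
    \<comment> \<open>Hitting \<open>x\<close> becomes a zero problem on the cube; the two bounds on
      \<open>x $ i\<close> give the sign conditions on the faces \<open>t $ i = 0\<close> and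
      \<open>t $ i = 1\<close>.\<close>
    have "\<exists>t\<in>cbox 0 1. f (?B t) - x = 0"
    proof (rule poincare_miranda)
      show "continuous_on (cbox 0 1) (\<lambda>t. f (?B t) - x)"
        using BP by (intro continuous_on_diff continuous_on_const continuous_on_compose2[OF cont])
          (auto intro!: continuous_intros)
      fix t :: "real ^ 'n" and i assume t: "t \<in> cbox 0 1"
      show "(f (?B t) - x) $ i \<le> 0" if "t $ i = 0"
        using dist_from_0[OF FP, of "?B t" i] mem_parallelotope_face[OF t that] x(1)[of i]
        by (simp add: f_def F)
      show "0 \<le> (f (?B t) - x) $ i" if "t $ i = 1"
      proof -
        have "?B t \<in> G i" unfolding G by (rule mem_parallelotope_face[OF t that])
        \<comment> \<open>\<open>d i\<close> is an infimum over both faces, hence a lower bound for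
          the distances from \<open>F i\<close> to a single point of \<open>G i\<close>.\<close>
        then have "d i \<le> ennreal (dist_from (F i) (?B t))"
          unfolding d finsler_setdist_def ennreal_dist_from[OF FP FN BP[OF t]]
          by (intro INF_mono) (auto intro: INF_lower)
        then have "ennreal (x $ i) \<le> ennreal (dist_from (F i) (?B t))" using x(2) order_trans by blast
        then show ?thesis by (subst (asm) ennreal_le_iff) (auto simp: f_def dist_from_def)
      qed
    qed
    then show "x \<in> f ` P" using BP by force
  qed
  \<comment> \<open>\<open>emeasure\<close> is 0 off the measurable sets, so monotonicity requires
    the larger set to be measurable. Compactness of \<open>P\<close> makes the image closed, and
    closed sets enter the sigma algebra as complements of open ones.\<close>
  have "f ` P \<in> sets (v (standard_manifold UNIV) sup_metric)"
  proof -
    have "closed (f ` P)"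
      by (intro compact_imp_closed compact_continuous_image cont) (simp add: P compact_parallelotope)
    then have "UNIV - (UNIV - f ` P) \<in> sigma_sets UNIV {U. open U}"
      by (intro sigma_sets.Compl sigma_sets.Basic) (auto simp: Compl_eq_Diff_UNIV[symmetric])
    then show ?thesis
      using finsler_volume_sets[OF assms(9) smooth_manifold_UNIV finsler_metric_sup_metric reversible_sup_metric]
      by (simp add: double_diff)
  qed
  then have "emeasure (v (standard_manifold UNIV) sup_metric) {x. \<forall>i. 0 \<le> x $ i \<and> ennreal (x $ i) \<le> d i}
      \<le> emeasure (v (standard_manifold UNIV) sup_metric) (f ` P)"
    by (rule emeasure_mono[OF box])
  also have "\<dots> \<le> emeasure (v (standard_manifold P) \<Phi>) P"
    using finsler_volume_short_map[OF assms(9) M \<Phi> smooth_manifold_UNIV finsler_metric_sup_metric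
        reversible_sup_metric, of f] dist_from_short[of F] FP FN by (simp add: f_def)
  finally show ?thesis .
qed

end
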